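(* Let $r,s$ be positive integers, let $\mathbf{n}=(n_1,\ldots,n_r)$ and $\mathbf{m}=(m_1,\ldots,m_s)$ be tuples of positive integers, and put $X_{\mathbf{n}}=\prod_{i=1}^r S^{2n_i-1}$ and $Y_{\mathbf{m}}=\prod_{j=1}^s S^{2m_j-1}$, with the coordinatewise scalar actions of the tori $T^r=(S^1)^r$ and $T^s=(S^1)^s$ respectively. Let $A=(a_{ji})\in M_{s\times r}(\mathbb{Z})$ and let $\phi\colon T^r\to T^s$ be the continuous homomorphism given by $\phi(z_1,\ldots,z_r)_j=\prod_{i=1}^r z_i^{a_{ji}}$ for $1\le j\le s$. If there exists a $\phi$-equivariant map $f\colon X_{\mathbf{n}}\to Y_{\mathbf{m}}$, then $$\bigl(L_1^{m_1},\ldots,L_s^{m_s}\bigr)\subseteq (x_1^{n_1},\ldots,x_r^{n_r})$$ as ideals in the polynomial ring $\mathbb{Z}[x_1,\ldots,x_r]$, where $L_j=\sum_{i=1}^r a_{ji}x_i$. Consequently, no such map exists if $$\left(\sum_{i=1}^r a_{ji}x_i\right)^{m_j}\notin (x_1^{n_1},\ldots,x_r^{n_r})$$ for some $j\in\{1,\ldots,s\}$.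
   Context: Coordinatewise scalar action: the $i$-th circle factor of $T^r$ acts by scalar multiplication on the $i$-th factor $S^{2n_i-1}\subset\mathbb{C}^{n_i}$ of $X_{\mathbf{n}}$ (and trivially on the others); analogously for $T^s$ on $Y_{\mathbf{m}}$ with $S^{2m_j-1}\subset\mathbb{C}^{m_j}$. A map $f\colon X\to Y$ from a $G$-space to an $H$-space is $\phi$-equivariant, for a continuous homomorphism $\phi\colon G\to H$, if it is continuous and $f(gx)=\phi(g)f(x)$ for all $g\in G$, $x\in X$. Every continuous homomorphism $T^r\to T^s$ has the form given by an integer matrix $A$. *)

theory Defs
  imports "HOL-Analysis.Analysis" "HOL-Library.Poly_Mapping"
begin

(* The tori and sphere products are indexed by finite types 'r and 's, so that
   r = CARD('r) and s = CARD('s) are arbitrary positive integers. *)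

definition torus :: "('r \<Rightarrow> complex) set" where
  "torus = {z. \<forall>i. cmod (z i) = 1}"

(* The unit sphere of C^n, i.e. S^(2n-1). Vectors of C^n are sequences vanishing from
   index n on; the product topology on sequences induces the Euclidean topology there. *)
definition csphere :: "nat \<Rightarrow> (nat \<Rightarrow> complex) set" where
  "csphere n = {v. (\<Sum>k<n. (cmod (v k))\<^sup>2) = 1 \<and> (\<forall>k\<ge>n. v k = 0)}"

definition sphere_prod :: "('r \<Rightarrow> nat) \<Rightarrow> ('r \<Rightarrow> nat \<Rightarrow> complex) set" where
  "sphere_prod n = {x. \<forall>i. x i \<in> csphere (n i)}"

definition scalar_act :: "('r \<Rightarrow> complex) \<Rightarrow> ('r \<Rightarrow> nat \<Rightarrow> complex) \<Rightarrow> ('r \<Rightarrow> nat \<Rightarrow> complex)" where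
  "scalar_act z x = (\<lambda>i k. z i * x i k)"

definition torus_hom :: "int ^ 'r ^ 's \<Rightarrow> ('r::finite \<Rightarrow> complex) \<Rightarrow> ('s::finite \<Rightarrow> complex)" where
  "torus_hom A z = (\<lambda>j. \<Prod>i\<in>UNIV. z i powi (A $ j $ i))"

definition equivariant_map ::
  "'g set \<Rightarrow> ('g \<Rightarrow> 'h) \<Rightarrow>
   ('g \<Rightarrow> 'a \<Rightarrow> 'a) \<Rightarrow> 'a::topological_space set \<Rightarrow>
   ('h \<Rightarrow> 'b \<Rightarrow> 'b) \<Rightarrow> 'b::topological_space set \<Rightarrow> ('a \<Rightarrow> 'b) \<Rightarrow> bool" where
  "equivariant_map G \<phi> actX X actY Y f \<longleftrightarrow>
     continuous_on X f \<and> f ` X \<subseteq> Y \<and>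
     (\<forall>g\<in>G. \<forall>x\<in>X. f (actX g x) = actY (\<phi> g) (f x))"

(* Z[x_i : i in 'r] as the monoid ring over Z of the finitely supported exponent
   vectors. *)
type_synonym 'r zpoly = "('r \<Rightarrow>\<^sub>0 nat) \<Rightarrow>\<^sub>0 int"

definition pvar :: "'r \<Rightarrow> 'r zpoly" where
  "pvar i = Poly_Mapping.single (Poly_Mapping.single i 1) 1"

definition lin_form :: "int ^ 'r ^ 's \<Rightarrow> 's::finite \<Rightarrow> 'r::finite zpoly" where
  "lin_form A j = (\<Sum>i\<in>UNIV. of_int (A $ j $ i) * pvar i)"

(* Ideals are the submodules of the ring regarded as a module over itself. *)
definition ideal_gen :: "'a::comm_ring_1 set \<Rightarrow> 'a set" where
  "ideal_gen S = module.span (*) S"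

lemma module_mult: "module ((*) :: 'a::comm_ring_1 \<Rightarrow> 'a \<Rightarrow> 'a)"
  by unfold_locales (simp_all add: algebra_simps)

lemma ideal_gen_explicit:
  "ideal_gen S = {\<Sum>a\<in>t. c a * a |t c. finite t \<and> t \<subseteq> (S :: 'a::comm_ring_1 set)}"
  by (simp add: ideal_gen_def module.span_explicit[OF module_mult])

lemma scalar_act_sphere_prod:
  assumes "z \<in> torus" "x \<in> sphere_prod n"
  shows "scalar_act z x \<in> sphere_prod n"
  using assms
  by (auto simp: torus_def sphere_prod_def csphere_def scalar_act_def norm_mult)

lemma torus_hom_in_torus: "z \<in> torus \<Longrightarrow> torus_hom A z \<in> torus"
  by (simp add: torus_def torus_hom_def prod_norm[symmetric] norm_power_int)

lemma torus_hom_mult: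
  "torus_hom A (\<lambda>i. z i * w i) = (\<lambda>j. torus_hom A z j * torus_hom A w j)"
  by (simp add: torus_hom_def power_int_mult_distrib prod.distrib)

lemma continuous_on_torus_hom: "continuous_on torus (torus_hom A)"
  unfolding torus_hom_def
proof (rule continuous_on_coordinatewise_then_product)
  fix j
  show "continuous_on torus (\<lambda>z. \<Prod>i\<in>UNIV. z i powi (A $ j $ i))"
    by (intro continuous_intros continuous_on_subset[OF continuous_on_product_coordinates])
       (auto simp: torus_def, metis norm_zero zero_neq_one)
qed

end

theory Submission
  imports Defs "HOL-Homology.Homology" "HOL-Computational_Algebra.Polynomial"
begin

text \<open>
  Suppose a monomial of \<open>L^m\<close> has exponents \<open>\<alpha> i < n i\<close>; its variables have nonzero coefficients in
  \<open>L\<close>. Multiplying linear forms gives an equivariant map from \<open>\<alpha> i\<close> copies of \<open>S\<^sup>3\<close> to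
  \<open>S\<^bsup>2\<alpha> i + 1\<^esup>\<close>. After conjugating the factors with negative coefficients,
  composing with \<open>f\<close> and restricting \<open>S\<^sup>3\<close> to the disc \<open>w \<mapsto> (w, 1 - |w|)\<close> yields a nowhere
  vanishing map \<open>G\<close> from the polydisc in complex \<open>m\<close>-space to itself, where \<open>G w = w k ^ b k * G (w(k := 1))\<close> whenever
  \<open>|w k| = 1\<close>, with all \<open>b k > 0\<close>; this is a section of a sum of \<open>m\<close> equal line bundles over a product of
  \<open>m\<close> projective lines.

  Any two such maps that do not vanish on the boundary are homotopic there through such maps: the
  homotopy is constructed cell by cell, and every obstruction lies in a homotopy group of
  \<open>S\<^bsup>2m-1\<^esup>\<close> below the dimension of that sphere. So \<open>G\<close> has on the boundary the same degree as the map given by the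
  coefficients of \<open>\<Prod>k. (1 - |w k|) + w k ^ b k T\<close>. The latter deforms to the elementary symmetric
  functions of the \<open>w k ^ b k\<close>, whose degree is nonzero (it is \<open>m! \<Prod>k. b k\<close> up to sign), while \<open>G\<close> extends
  over the polydisc without zeros and so has degree \<open>0\<close>.
\<close>

subsection \<open>Degree and suspension\<close>

text \<open>The number m! * prod b is the coefficient of h_0 ... h_(m-1) in (sum of b k * h_k)^m: it
  is the Euler number of the sum of line bundles. Each projective line stands for one factor of the
  power L^m, and a monomial chooses a variable for every factor. Multiplication of linear forms
  merges the lines with the same variable: a product of \<alpha> i nonzero forms is a nonzero
  polynomial with \<alpha> i + 1 \<le> n i coefficients, and rescaling one form rescales the
  product. This is where exponents below n i are used. The obstacle is that the homotopy must
  respect the twisted periodicity on every face |w k| = 1. The slice w k = 1 is a fundamental domain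
  of that face, and the values on it determine all others. Together with time, such a slice has real
  dimension at most 2 (m - 1) + 1, less than the 2 m real components of a value, so a small shift of
  a Lipschitz map avoids zero. Over the full polydisc with time the dimension would be 2 m + 1; only
  the cylinder over the boundary can be filled in this way.\<close>

lemma Brouwer_degree2_suspension:
  assumes f: "continuous_map (nsphere n) (nsphere n) f"
    and g: "continuous_map (nsphere (Suc n)) (nsphere (Suc n)) g"
    and eq: "\<And>x. x \<in> topspace (nsphere n) \<Longrightarrow> g x = f x"
    and up: "\<And>x. x \<in> topspace (nsphere (Suc n)) \<Longrightarrow> x (Suc n) \<ge> 0 \<Longrightarrow> g x (Suc n) \<ge> 0"
    and lo: "\<And>x. x \<in> topspace (nsphere (Suc n)) \<Longrightarrow> x (Suc n) \<le> 0 \<Longrightarrow> g x (Suc n) \<le> 0"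
  shows "Brouwer_degree2 (Suc n) g = Brouwer_degree2 n f"
proof (rule Brouwer_degree2_unique [OF g])
  let ?S = "nsphere (Suc n)" and ?p = "int (Suc n)"
  let ?L = "topspace ?S \<inter> {x. x (Suc n) \<le> 0}" and ?U = "topspace ?S \<inter> {x. x (Suc n) \<ge> 0}"
  let ?E = "topspace ?S \<inter> {x. x (Suc n) = 0}"
  let ?H = "subtopology ?S {x. x (Suc n) \<ge> 0}"
  let ?G = "reduced_homology_group ?p ?S"
  let ?B = "reduced_homology_group (int n) (nsphere n)"
  let ?R = "relative_homology_group ?p ?H {x. x (Suc n) = 0}"
  let ?Q = "relative_homology_group ?p ?S {x. x (Suc n) \<le> 0}"
  let ?j = "hom_induced ?p ?S {} ?S {x. x (Suc n) \<le> 0} id"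
  let ?e = "hom_induced ?p ?H {x. x (Suc n) = 0} ?S {x. x (Suc n) \<le> 0} id"
  let ?b = "hom_boundary ?p ?H {x. x (Suc n) = 0}"
  let ?d = "Brouwer_degree2 n f"
  note of_nat_Suc [simp del]
  have j: "?j \<in> iso ?G ?Q"
    using iso_reduced_homology_group_lower_hemisphere[of "Suc n" "Suc n" ?p] by simp
  have e: "?e \<in> iso ?R ?Q"
    by (rule iso_relative_homology_group_upper_hemisphere)
  have b: "?b \<in> iso ?R ?B"
    using iso_upper_hemisphere_reduced_homology_group[of "int n" n] by (simp add: of_nat_Suc)
  have *: "group ?G" "group ?Q" "group ?R" "group ?B" by simp_all
  interpret j: group_hom ?G ?Q ?j using j * by (simp add: group_hom_def group_hom_axioms_def iso_def)
  interpret e: group_hom ?R ?Q ?e using e * by (simp add: group_hom_def group_hom_axioms_def iso_def)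
  interpret b: group_hom ?R ?B ?b using b * by (simp add: group_hom_def group_hom_axioms_def iso_def)
  \<comment> \<open>The inclusions \<open>hU\<close>, \<open>hL\<close>, \<open>hE\<close> concern
    whole half-spaces and not only their traces on the sphere, so \<open>g\<close> is replaced by
    the identity off the sphere.\<close>
  define h where "h = (\<lambda>x. if x \<in> topspace ?S then g x else x)"
  have h: "continuous_map ?S ?S h"
    by (rule continuous_map_eq[OF g]) (simp add: h_def)
  have hg: "h x = g x" if "x \<in> topspace ?S" for x
    using that by (simp add: h_def)
  have hU: "h \<in> {x. x (Suc n) \<ge> 0} \<rightarrow> {x. x (Suc n) \<ge> 0}" and hL: "h \<in> {x. x (Suc n) \<le> 0} \<rightarrow> {x. x (Suc n) \<le> 0}"
    and hE: "h \<in> {x. x (Suc n) = 0} \<rightarrow> {x. x (Suc n) = 0}"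
    using up lo by (auto simp: h_def intro: antisym)
  have hH: "continuous_map ?H ?H h"
    using hU by (auto simp: continuous_map_in_subtopology continuous_map_from_subtopology[OF h])
  let ?R' = "hom_induced ?p ?H {x. x (Suc n) = 0} ?H {x. x (Suc n) = 0} h"
  let ?Q' = "hom_induced ?p ?S {x. x (Suc n) \<le> 0} ?S {x. x (Suc n) \<le> 0} h"
  let ?G' = "hom_induced ?p ?S {} ?S {} h"
  have sub: "subtopology ?H {x. x (Suc n) = 0} = nsphere n"
  proof -
    have "{x. 0 \<le> x (Suc n)} \<inter> {x. x (Suc n) = 0} = {x::nat\<Rightarrow>real. x (Suc n) = 0}"
      by auto
    then show ?thesis
      by (simp add: subtopology_nsphere_equator subtopology_subtopology)
  qed
  have j_inj: "inj_on ?j (carrier ?G)" and b_inj: "inj_on ?b (carrier ?R)"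
    using j b unfolding iso_iff by blast+
  have ids: "continuous_map ?S ?S id" and idH: "continuous_map ?H ?S id"
    by (simp_all add: continuous_map_from_subtopology)
  have empty_fun: "h \<in> {} \<rightarrow> {}" and ide: "id \<in> {} \<rightarrow> {x::nat\<Rightarrow>real. x (Suc n) \<le> 0}"
    and id0: "id \<in> {x::nat\<Rightarrow>real. x (Suc n) = 0} \<rightarrow> {x. x (Suc n) \<le> 0}"
    by auto
  have p1: "?p - 1 = int n"
    by (simp add: of_nat_Suc)
  have hf: "h x = f x" if x: "x \<in> topspace (nsphere n)" for x
    using x hg[of x] eq[OF x] topspace_subtopology[of "nsphere (Suc n)" "{x. x (Suc n) = 0}"]
    unfolding subtopology_nsphere_equator by auto
  \<comment> \<open>The isomorphisms \<open>?j\<close>, \<open>?e\<close> and \<open>?b\<close> lead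
    from the homology of the large sphere to that of its equator. They commute with the maps induced
    by \<open>h\<close>, and integer powers pass through them.\<close>
  have "?G' x = x [^]\<^bsub>?G\<^esub> ?d" if x: "x \<in> carrier ?G" for x
  proof -
    have "?j x \<in> carrier ?Q" using x by (rule j.hom_closed)
    then have "?j x \<in> ?e ` carrier ?R"
      using conjunct1[OF conjunct2[OF iso_iff[THEN iffD1, OF e]]] by metis
    then obtain y where y: "?j x = ?e y" "y \<in> carrier ?R"
      by (rule imageE)
    have z: "?b y \<in> carrier ?B" using y(2) by (rule b.hom_closed)
    have "?b (?R' y) = hom_induced (int n) (nsphere n) {} (nsphere n) {} h (?b y)"
      using naturality_hom_induced[OF hH hE, of ?p, THEN fun_cong, of y] unfolding sub p1 o_def .
    also have "\<dots> = hom_induced (int n) (nsphere n) {} (nsphere n) {} f (?b y)"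
      by (rule arg_cong[where f="\<lambda>k. k _", OF hom_induced_eq[OF hf]])
    also have "\<dots> = ?b y [^]\<^bsub>?B\<^esub> ?d"
      using z by (rule Brouwer_degree2)
    also have "\<dots> = ?b (y [^]\<^bsub>?R\<^esub> ?d)"
      by (rule b.hom_int_pow[OF y(2), symmetric])
    finally have 1: "?R' y = y [^]\<^bsub>?R\<^esub> ?d"
      by (rule inj_onD[OF b_inj _ hom_induced_carrier e.G.int_pow_closed[OF y(2)]])
    have "?j (?G' x) = ?Q' (?j x)"
      unfolding hom_induced_compose'[OF h empty_fun ids ide] hom_induced_compose'[OF ids ide h hL] by simp
    also have "\<dots> = ?e (?R' y)"
      unfolding y(1) hom_induced_compose'[OF idH id0 h hL] hom_induced_compose'[OF hH hE idH id0]
      by simp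
    also have "\<dots> = ?j x [^]\<^bsub>?Q\<^esub> ?d"
      unfolding 1 y(1) by (rule e.hom_int_pow[OF y(2)])
    also have "\<dots> = ?j (x [^]\<^bsub>?G\<^esub> ?d)"
      by (rule j.hom_int_pow[OF x, symmetric])
    finally show ?thesis
      by (rule inj_onD[OF j_inj _ hom_induced_reduced[OF x] j.G.int_pow_closed[OF x]])
  qed
  moreover have hgi: "?G' = hom_induced ?p ?S {} ?S {} g"
    by (rule hom_induced_eq[OF hg])
  ultimately show "hom_induced ?p ?S {} ?S {} g x = x [^]\<^bsub>?G\<^esub> ?d" if "x \<in> carrier ?G" for x
    using that unfolding hgi by blast
qed

subsection \<open>The degree of a power map of the circle\<close>

definition edge_point :: "real \<Rightarrow> nat \<Rightarrow> real" where
  "edge_point t = (\<lambda>i. if i = 0 then 1 - t else if i = 1 then t else 0)"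

definition has_increment :: "((nat \<Rightarrow> real) \<Rightarrow> nat \<Rightarrow> real) \<Rightarrow> complex \<Rightarrow> bool" where
  "has_increment \<sigma> d \<longleftrightarrow> (\<exists>g. continuous_on {0..1} g \<and>
     (\<forall>t\<in>{0..1}. Complex (\<sigma> (edge_point t) 0) (\<sigma> (edge_point t) 1) = exp (g t)) \<and> d = g 1 - g 0)"

text \<open>
  The increment of a continuous logarithm along a singular 1-simplex is additive on chains and
  vanishes on boundaries, so it detects nonzero classes in the first homology group of the circle.
\<close>

definition increment :: "((nat \<Rightarrow> real) \<Rightarrow> nat \<Rightarrow> real) \<Rightarrow> complex" where
  "increment \<sigma> = (SOME d. has_increment \<sigma> d)"

definition chain_increment :: "(nat \<Rightarrow> real) chain \<Rightarrow> complex" where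
  "chain_increment c = (\<Sum>\<sigma>\<in>Poly_Mapping.keys c. of_int (Poly_Mapping.lookup c \<sigma>) * increment \<sigma>)"

text \<open>Two logarithms of one path differ pointwise by integer multiples of 2 pi i. Distinct
  multiples are at least 2 pi apart, so a continuous difference on an interval is constant.\<close>

lemma has_increment_unique:
  assumes "has_increment \<sigma> d" "has_increment \<sigma> d'"
  shows "d = d'"
proof -
  obtain g g' where g: "continuous_on {0..1::real} g" "continuous_on {0..1} g'"
    "\<And>t. t \<in> {0..1} \<Longrightarrow> exp (g t) = exp (g' t)" "d = g 1 - g 0" "d' = g' 1 - g' 0"
    using assms unfolding has_increment_def by metis
  have 2: "\<exists>n. g t - g' t = of_int (2 * n) * pi * \<i>" if "t \<in> {0..1}" for t
    using g(3)[OF that] by (metis (no_types, lifting) add_diff_cancel_left' exp_eq)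
  have "(\<lambda>t. g t - g' t) constant_on {0..1}"
  proof (rule continuous_discrete_range_constant)
    show "\<exists>e>0. \<forall>y. y \<in> {0..1} \<and> g y - g' y \<noteq> g x - g' x \<longrightarrow> e \<le> norm (g y - g' y - (g x - g' x))"
      if x: "x \<in> {0..1}" for x
    proof (intro exI[of _ "2*pi"] conjI allI impI; (elim conjE)?)
      fix y assume y: "y \<in> {0..1::real}" "g y - g' y \<noteq> g x - g' x"
      obtain a b where ab: "g x - g' x = of_int (2 * a) * pi * \<i>" "g y - g' y = of_int (2 * b) * pi * \<i>"
        using 2 x y by blast
      then have *: "g y - g' y - (g x - g' x) = of_int (2 * (b - a)) * pi * \<i>"
        by (simp add: algebra_simps)
      have "b \<noteq> a" using ab y by auto
      then have "1 \<le> \<bar>real_of_int (b - a)\<bar>" by linarith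
      then have "2 * pi * 1 \<le> 2 * pi * \<bar>real_of_int (b - a)\<bar>"
        by (intro mult_left_mono) auto
      also have "\<dots> = norm (of_int (2 * (b - a)) * pi * \<i>)"
        by (simp only: norm_mult norm_of_int norm_of_real norm_ii of_int_mult abs_mult) simp
      finally show "2 * pi \<le> norm (g y - g' y - (g x - g' x))"
        unfolding * by simp
    qed auto
  qed (use g in \<open>auto intro!: continuous_intros\<close>)
  then have "g 1 - g' 1 = g 0 - g' 0"
    by (auto simp: constant_on_def)
  then have "g 1 - g 0 = g' 1 - g' 0"
    by (simp add: algebra_simps)
  then show ?thesis using g by simp
qed

lemma increment_eq: "has_increment \<sigma> d \<Longrightarrow> increment \<sigma> = d"
  unfolding increment_def by (rule some_equality) (auto dest: has_increment_unique)

lemma chain_increment_superset: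
  assumes "finite A" "Poly_Mapping.keys c \<subseteq> A"
  shows "chain_increment c = (\<Sum>\<sigma>\<in>A. of_int (Poly_Mapping.lookup c \<sigma>) * increment \<sigma>)"
  unfolding chain_increment_def
  by (rule sum.mono_neutral_left) (use assms in \<open>auto simp: in_keys_iff\<close>)

lemma chain_increment_diff: "chain_increment (a - b) = chain_increment a - chain_increment b"
proof -
  let ?A = "Poly_Mapping.keys a \<union> Poly_Mapping.keys b"
  have "Poly_Mapping.keys (a - b) \<subseteq> ?A" by (rule keys_diff)
  then show ?thesis
    by (simp add: chain_increment_superset[of ?A] lookup_minus algebra_simps sum_subtractf)
qed

lemma chain_increment_0 [simp]: "chain_increment 0 = 0"
  by (simp add: chain_increment_def)

lemma chain_increment_of [simp]: "chain_increment (frag_of \<sigma>) = increment \<sigma>"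
  by (simp add: chain_increment_def)

lemma chain_increment_add: "chain_increment (a + b) = chain_increment a + chain_increment b"
  using chain_increment_diff[of a "0 - b"] chain_increment_diff[of 0 b] by simp

text \<open>A triangle is contractible, so a single logarithm \<open>g\<close> serves all three
  edges, and the alternating sum of its differences between vertices telescopes to 0.\<close>

lemma chain_increment_boundary_of:
  assumes "singular_simplex 2 (nsphere 1) \<tau>"
  shows "chain_increment (chain_boundary 2 (frag_of \<tau>)) = 0"
proof -
  \<comment> \<open>Barycentric coordinates on the planar triangle with vertices 0, 1 and i. Face
    number k omits vertex number k, so face 0 runs from 1 to i.\<close>
  define tri where "tri z = (\<lambda>i::nat. if i = 0 then 1 - Re z - Im z else if i = 1 then Re z else if i = 2 then Im z else 0)" for z
  define T where "T = {z. 0 \<le> Re z \<and> 0 \<le> Im z \<and> Re z + Im z \<le> 1}"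
  define G where "G z = Complex (\<tau> (tri z) 0) (\<tau> (tri z) 1)" for z
  have tri: "tri z \<in> standard_simplex 2" if "z \<in> T" for z
    using that by (auto simp: standard_simplex_def tri_def T_def numeral_2_eq_2)
  have "convex T"
  proof -
    have "T = {z. Re z \<ge> 0} \<inter> {z. Im z \<ge> 0} \<inter> {z. Complex 1 1 \<bullet> z \<le> 1}"
      by (auto simp: T_def inner_complex_def)
    then show ?thesis
      by (simp only:) (intro convex_Int convex_halfspace_Re_ge convex_halfspace_Im_ge convex_halfspace_le)
  qed
  have cont_tri: "continuous_map (top_of_set T) (subtopology (powertop_real UNIV) (standard_simplex 2)) tri"
    unfolding continuous_map_in_subtopology continuous_map_componentwise_UNIV
  proof (intro conjI allI)
    show "continuous_map (top_of_set T) euclideanreal (\<lambda>x. tri x k)" for k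
      unfolding tri_def by (cases "k = 0"; cases "k = 1"; cases "k = 2") (auto intro!: continuous_intros)
  qed (use tri in auto)
  have "continuous_map (top_of_set T) (nsphere 1) (\<tau> \<circ> tri)"
    using assms continuous_map_compose[OF cont_tri] unfolding singular_simplex_def by blast
  then have \<tau>: "continuous_map (top_of_set T) (powertop_real UNIV) (\<tau> \<circ> tri)" "\<And>z. z \<in> T \<Longrightarrow> \<tau> (tri z) \<in> topspace (nsphere 1)"
    by (auto simp: nsphere continuous_map_in_subtopology Pi_iff)
  have "continuous_on T (\<lambda>z. \<tau> (tri z) i)" for i
    using \<tau>(1) by (simp add: continuous_map_componentwise_UNIV)
  then have "continuous_on T G"
    unfolding G_def Complex_eq by (intro continuous_intros)
  moreover have "G z \<noteq> 0" if "z \<in> T" for z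
    using \<tau>(2)[OF that] by (auto simp: G_def nsphere complex_eq_iff)
  moreover have "contractible T"
    by (rule convex_imp_contractible) fact
  ultimately obtain g where g: "continuous_on T g" "\<And>z. z \<in> T \<Longrightarrow> G z = exp (g z)"
    using continuous_logarithm_on_contractible[of T G] by blast
  have edge: "edge_point t \<in> standard_simplex (2 - Suc 0)" if "t \<in> {0..1}" for t
    using that by (auto simp: edge_point_def standard_simplex_def)
  have inc: "increment (singular_face 2 k \<tau>) = g (z 1) - g (z 0)"
    if z: "continuous_on {0..1} z" "\<And>t. t \<in> {0..1} \<Longrightarrow> z t \<in> T"
      "\<And>t. t \<in> {0..1} \<Longrightarrow> simplical_face k (edge_point t) = tri (z t)" for k z
  proof (rule increment_eq)
    show "has_increment (singular_face 2 k \<tau>) (g (z 1) - g (z 0))"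
      unfolding has_increment_def
    proof (intro exI[of _ "g \<circ> z"] conjI ballI)
      show "continuous_on {0..1} (g \<circ> z)"
        using z g by (intro continuous_on_compose) (auto intro: continuous_on_subset)
      show "Complex (singular_face 2 k \<tau> (edge_point t) 0) (singular_face 2 k \<tau> (edge_point t) 1) = exp ((g \<circ> z) t)"
        if "t \<in> {0..1}" for t
        using that z(2,3)[OF that] g(2)[of "z t"] edge[OF that] by (simp add: singular_face_def G_def)
    qed auto
  qed
  have z0: "increment (singular_face 2 0 \<tau>) = g (Complex 0 1) - g (Complex 1 0)"
  proof -
    have "continuous_on {0..1} (\<lambda>t. Complex (1 - t) t)"
      unfolding Complex_eq by (intro continuous_intros)
    moreover have "simplical_face 0 (edge_point t) = tri (Complex (1 - t) t)" for t
      by (auto simp: tri_def simplical_face_def edge_point_def fun_eq_iff)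
    ultimately show ?thesis
      using inc[of "\<lambda>t. Complex (1 - t) t" 0] by (simp add: T_def)
  qed
  have z1: "increment (singular_face 2 1 \<tau>) = g (Complex 0 1) - g (Complex 0 0)"
  proof -
    have "continuous_on {0..1} (\<lambda>t. Complex 0 t)"
      unfolding Complex_eq by (intro continuous_intros)
    moreover have "simplical_face 1 (edge_point t) = tri (Complex 0 t)" for t
      by (auto simp: tri_def simplical_face_def edge_point_def fun_eq_iff)
    ultimately show ?thesis
      using inc[of "\<lambda>t. Complex 0 t" 1] by (simp add: T_def)
  qed
  have z2: "increment (singular_face 2 2 \<tau>) = g (Complex 1 0) - g (Complex 0 0)"
  proof -
    have "continuous_on {0..1} (\<lambda>t. Complex t 0)"
      unfolding Complex_eq by (intro continuous_intros)
    moreover have "simplical_face 2 (edge_point t) = tri (Complex t 0)" for t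
      by (auto simp: tri_def simplical_face_def edge_point_def fun_eq_iff)
    ultimately show ?thesis
      using inc[of "\<lambda>t. Complex t 0" 2] by (simp add: T_def)
  qed
  have "chain_boundary 2 (frag_of \<tau>) = frag_of (singular_face 2 0 \<tau>) - frag_of (singular_face 2 1 \<tau>) + frag_of (singular_face 2 2 \<tau>)"
    by (simp add: chain_boundary_of numeral_2_eq_2)
  then show ?thesis
    by (simp add: chain_increment_add chain_increment_diff z0 z1[simplified] z2)
qed

lemma chain_increment_boundary:
  assumes "singular_chain 2 (nsphere 1) c"
  shows "chain_increment (chain_boundary 2 c) = 0"
  using assms[unfolded singular_chain_def]
  by (induction c rule: frag_induction)
     (auto simp: chain_increment_boundary_of chain_boundary_diff chain_increment_diff)

text \<open>In degree 0 the image of the loop winding once around the circle would bound. Boundaries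
  have increment 0, while this image has increment K * 2 pi i.\<close>

lemma degree_circle_power_nonzero:
  assumes f: "continuous_map (nsphere 1) (nsphere 1) f" and K: "K > 0"
    and pow: "\<And>x. x \<in> topspace (nsphere 1) \<Longrightarrow> Complex (f x 0) (f x 1) = Complex (x 0) (x 1) ^ K"
  shows "Brouwer_degree2 1 f \<noteq> 0"
proof
  assume deg: "Brouwer_degree2 1 f = 0"
  let ?X = "nsphere 1"
  define \<sigma> where "\<sigma> = restrict (\<lambda>x::nat\<Rightarrow>real. (\<lambda>i::nat. if i = 0 then cos (2 * pi * x 1) else if i = 1 then sin (2 * pi * x 1) else 0)) (standard_simplex 1)"
  have \<sigma>: "singular_simplex 1 ?X \<sigma>"
    unfolding singular_simplex_def nsphere continuous_map_in_subtopology
  proof (intro conjI)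
    have c: "continuous_map (subtopology (powertop_real UNIV) (standard_simplex 1)) euclideanreal (\<lambda>x. 2 * pi * x 1)"
      by (intro continuous_intros continuous_map_from_subtopology continuous_map_product_projection) auto
    have c1: "continuous_map (subtopology (powertop_real UNIV) (standard_simplex 1)) euclideanreal (\<lambda>x. cos (2 * pi * x 1))"
      using continuous_map_compose[OF c, of euclideanreal cos] by (simp add: o_def continuous_on_cos)
    have c2: "continuous_map (subtopology (powertop_real UNIV) (standard_simplex 1)) euclideanreal (\<lambda>x. sin (2 * pi * x 1))"
      using continuous_map_compose[OF c, of euclideanreal sin] by (simp add: o_def continuous_on_sin)
    have "continuous_map (subtopology (powertop_real UNIV) (standard_simplex 1)) (powertop_real UNIV) (\<lambda>x::nat\<Rightarrow>real. (\<lambda>i::nat. if i = 0 then cos (2 * pi * x 1) else if i = 1 then sin (2 * pi * x 1) else 0))"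
      unfolding continuous_map_componentwise_UNIV using c1 c2 by auto
    then show "continuous_map (subtopology (powertop_real UNIV) (standard_simplex 1)) (powertop_real UNIV) \<sigma>"
      by (rule continuous_map_eq) (simp add: \<sigma>_def)
  qed (auto simp: \<sigma>_def)
  have e: "x = (\<lambda>i. if i = 0 then 1 else 0)" if "x \<in> standard_simplex 0" for x :: "nat \<Rightarrow> real"
    using that by (simp add: standard_simplex_0)
  \<comment> \<open>The loop closes up by periodicity of cos and sin, so its two faces cancel and it
    is a cycle.\<close>
  have "singular_face 1 0 \<sigma> = singular_face 1 1 \<sigma>"
  proof -
    have "singular_face 1 k \<sigma> x = restrict (\<lambda>x i. if i = 0 then 1 else 0) (standard_simplex 0) x" if k: "k \<le> 1" for k x
    proof (cases "x \<in> standard_simplex 0")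
      case True
      then have "simplical_face k x \<in> standard_simplex 1"
        using simplical_face_in_standard_simplex[of 1 k x] k by simp
      moreover have "simplical_face k x 1 = 0 \<or> simplical_face k x 1 = 1"
        using e[OF True] k by (auto simp: simplical_face_def)
      ultimately show ?thesis
        using True by (auto simp: singular_face_def \<sigma>_def)
    qed (simp add: singular_face_def)
    then show ?thesis
      by (intro ext) simp
  qed
  then have "chain_boundary 1 (frag_of \<sigma>) = 0"
    by (simp add: chain_boundary_of)
  then have cyc: "singular_relcycle 1 ?X {} (frag_of \<sigma>)"
    by (simp add: singular_cycle singular_chain_of \<sigma>[simplified])
  let ?x = "homologous_rel_set 1 ?X {} (frag_of \<sigma>)"
  let ?G = "reduced_homology_group (int 1) ?X"
  have G: "?G = homology_group (int 1) ?X"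
    by (rule un_reduced_homology_group) simp
  have "?x \<in> carrier ?G"
    unfolding G carrier_relative_homology_group using cyc by blast
  then have "hom_induced (int 1) ?X {} ?X {} f ?x = ?x [^]\<^bsub>?G\<^esub> (0::int)"
    using Brouwer_degree2[of ?x 1 f] deg by simp
  also have "\<dots> = singular_relboundary_set 1 ?X {}"
    unfolding G int_pow_0 one_relative_homology_group ..
  also have "hom_induced (int 1) ?X {} ?X {} f ?x = homologous_rel_set 1 ?X {} (chain_map 1 f (frag_of \<sigma>))"
    by (rule hom_induced_chain_map[OF f _ cyc]) auto
  finally have "singular_relboundary 1 ?X {} (chain_map 1 f (frag_of \<sigma>))"
    by (simp add: homologous_rel_set_eq_relboundary)
  then obtain c where "singular_chain 2 ?X c" "chain_boundary 2 c = chain_map 1 f (frag_of \<sigma>)"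
    by (auto simp: singular_boundary numeral_2_eq_2)
  then have 0: "increment (simplex_map 1 f \<sigma>) = 0"
    using chain_increment_boundary[of c] by simp
  have "has_increment (simplex_map 1 f \<sigma>) (of_nat K * (2 * pi * \<i>))"
    unfolding has_increment_def
  proof (intro exI[of _ "\<lambda>t. of_nat K * (2 * pi * \<i> * of_real t)"] conjI ballI)
    fix t :: real assume t: "t \<in> {0..1}"
    then have et: "edge_point t \<in> standard_simplex 1"
      by (auto simp: edge_point_def standard_simplex_def)
    have "\<sigma> (edge_point t) \<in> topspace ?X"
      using \<sigma> et continuous_map_image_subset_topspace by (fastforce simp: singular_simplex_def)
    then have "Complex (f (\<sigma> (edge_point t)) 0) (f (\<sigma> (edge_point t)) 1) =
       Complex (\<sigma> (edge_point t) 0) (\<sigma> (edge_point t) 1) ^ K"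
      by (rule pow)
    also have "Complex (\<sigma> (edge_point t) 0) (\<sigma> (edge_point t) 1) = cis (2 * pi * t)"
      using et by (simp add: \<sigma>_def cis.ctr edge_point_def)
    also have "\<dots> ^ K = exp (of_nat K * (2 * pi * \<i> * of_real t))"
      by (simp only: cis_conv_exp flip: exp_of_nat_mult) (simp add: mult_ac)
    finally show "Complex (simplex_map 1 f \<sigma> (edge_point t) 0) (simplex_map 1 f \<sigma> (edge_point t) 1) = exp (of_nat K * (2 * pi * \<i> * of_real t))"
      using et by (simp add: simplex_map_def)
  qed (auto intro!: continuous_intros)
  then have "of_nat K * (2 * pi * \<i>) = 0"
    using increment_eq 0 by metis
  then show False using K by simp
qed

subsection \<open>Degree of nonvanishing maps on a sphere\<close>

definition sph :: "nat \<Rightarrow> (nat \<Rightarrow> real) set" where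
  "sph p = {x. (\<Sum>i\<le>p. (x i)\<^sup>2) = 1 \<and> (\<forall>i>p. x i = 0)}"

definition unit_vec :: "nat \<Rightarrow> (nat \<Rightarrow> real) \<Rightarrow> nat \<Rightarrow> real" where
  "unit_vec p y = (\<lambda>i. if i \<le> p then y i / sqrt (\<Sum>j\<le>p. (y j)\<^sup>2) else 0)"

text \<open>Normalizing inside the definition gives a degree to any map that avoids 0 in its
  coordinates up to \<open>p\<close>, so homotopies may leave the sphere.\<close>

definition sphere_degree :: "nat \<Rightarrow> ((nat \<Rightarrow> real) \<Rightarrow> nat \<Rightarrow> real) \<Rightarrow> int" where
  "sphere_degree p F = Brouwer_degree2 p (\<lambda>x. unit_vec p (F x))"

lemma nsphere_eq: "nsphere p = top_of_set (sph p)"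
  unfolding sph_def by (simp add: nsphere euclidean_product_topology)

lemma topspace_nsphere [simp]: "topspace (nsphere p) = sph p"
  by (simp add: nsphere_eq)

lemma sum_squares_pos: "\<exists>i\<le>p. y i \<noteq> 0 \<Longrightarrow> (\<Sum>j\<le>p. (y j)\<^sup>2) > (0::real)" for p :: nat
  by (auto intro!: sum_pos2)

lemma euclidean_prod_euclidean: "prod_topology euclidean euclidean = euclidean"
  by (auto simp: topology_eq openin_prod_topology_alt open_prod_def mem_Times_iff subset_iff; metis)

lemma unit_vec_in_sph: "\<exists>i\<le>p. y i \<noteq> 0 \<Longrightarrow> unit_vec p y \<in> sph p"
  using sum_squares_pos[of p y]
  by (simp add: sph_def unit_vec_def power_divide sum_nonneg flip: sum_divide_distrib)

lemma sph_nonzero: "x \<in> sph p \<Longrightarrow> \<exists>i\<le>p. x i \<noteq> 0"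
  by (rule ccontr) (auto simp: sph_def)

lemma continuous_on_unit_vec:
  assumes "\<And>i. i \<le> p \<Longrightarrow> continuous_on X (\<lambda>z. F z i)" "\<And>z. z \<in> X \<Longrightarrow> \<exists>i\<le>p. F z i \<noteq> 0"
  shows "continuous_on X (\<lambda>z. unit_vec p (F z))"
proof (rule continuous_on_coordinatewise_then_product)
  fix i
  have "(\<Sum>j\<le>p. (F z j)\<^sup>2) \<noteq> 0" if "z \<in> X" for z
    using sum_squares_pos[OF assms(2)[OF that]] by simp
  then show "continuous_on X (\<lambda>z. unit_vec p (F z) i)"
    unfolding unit_vec_def using assms(1) by (cases "i \<le> p") (auto intro!: continuous_intros)
qed

lemma continuous_map_unit_vec:
  assumes "\<And>i. i \<le> p \<Longrightarrow> continuous_on X (\<lambda>z. F z i)" "\<And>z. z \<in> X \<Longrightarrow> \<exists>i\<le>p. F z i \<noteq> 0"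
  shows "continuous_map (top_of_set X) (nsphere p) (\<lambda>z. unit_vec p (F z))"
  unfolding nsphere_eq continuous_map_subtopology_eu
  using continuous_on_unit_vec[of p X F] assms unit_vec_in_sph by auto

lemma sphere_degree_homotopy:
  fixes H :: "real \<Rightarrow> (nat \<Rightarrow> real) \<Rightarrow> nat \<Rightarrow> real"
  assumes "\<And>i. i \<le> p \<Longrightarrow> continuous_on ({0..1} \<times> sph p) (\<lambda>z. H (fst z) (snd z) i)"
    and "\<And>t x. t \<in> {0..1} \<Longrightarrow> x \<in> sph p \<Longrightarrow> \<exists>i\<le>p. H t x i \<noteq> 0"
  shows "sphere_degree p (H 0) = sphere_degree p (H 1)"
  unfolding sphere_degree_def
proof (rule Brouwer_degree2_homotopic)
  have c: "continuous_map (top_of_set ({0..1} \<times> sph p)) (nsphere p) (\<lambda>z. unit_vec p (H (fst z) (snd z)))"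
    by (rule continuous_map_unit_vec) (use assms in auto)
  have e: "prod_topology (top_of_set {0..1::real}) (nsphere p) = top_of_set ({0..1} \<times> sph p)"
    unfolding nsphere_eq by (simp add: euclidean_prod_euclidean flip: subtopology_Times)
  show "homotopic_with (\<lambda>x. True) (nsphere p) (nsphere p) (\<lambda>x. unit_vec p (H 0 x)) (\<lambda>x. unit_vec p (H 1 x))"
    unfolding homotopic_with_def by (intro exI[of _ "\<lambda>z. unit_vec p (H (fst z) (snd z))"]) (simp add: c e)
qed

lemma sphere_degree_const: "sphere_degree p (\<lambda>x. c) = 0"
  by (simp add: sphere_degree_def Brouwer_degree2_const)

lemma sphere_degree_cong:
  "(\<And>x i. x \<in> sph p \<Longrightarrow> i \<le> p \<Longrightarrow> F x i = G x i) \<Longrightarrow> sphere_degree p F = sphere_degree p G"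
  unfolding sphere_degree_def by (rule Brouwer_degree2_eq) (auto simp: unit_vec_def fun_eq_iff)

text \<open>As \<open>G\<close> need not be homogeneous, normalizing \<open>F x\<close> before
  applying \<open>G\<close> changes the map. The segment \<open>K\<close> from \<open>F x\<close> to
  its normalization stays on one ray and misses 0, so the degree survives.\<close>

lemma sphere_degree_compose:
  assumes F: "continuous_on (sph p) F" "\<And>x. x \<in> sph p \<Longrightarrow> \<exists>i\<le>p. F x i \<noteq> 0"
    and G: "\<And>i. i \<le> p \<Longrightarrow> continuous_on UNIV (\<lambda>x. G x i)" "\<And>x. \<exists>i\<le>p. x i \<noteq> 0 \<Longrightarrow> \<exists>i\<le>p. G x i \<noteq> 0"
  shows "sphere_degree p (\<lambda>x. G (F x)) = sphere_degree p G * sphere_degree p F"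
proof -
  define K where "K t x = (\<lambda>i. (1 - t) * F x i + t * unit_vec p (F x) i)" for t x
  have Fc: "continuous_on (sph p) (\<lambda>x. F x i)" for i
    using F(1) by (rule continuous_on_product_then_coordinatewise)
  have Uc: "continuous_on (sph p) (\<lambda>x. unit_vec p (F x) i)" for i
    by (rule continuous_on_product_then_coordinatewise, rule continuous_on_unit_vec) (use Fc F(2) in blast)+
  have "continuous_on ({0..1} \<times> sph p) (\<lambda>z. K (fst z) (snd z))"
    unfolding K_def
    by (intro continuous_on_coordinatewise_then_product continuous_intros
          continuous_on_compose2[OF Fc] continuous_on_compose2[OF Uc]) auto
  then have "sphere_degree p (\<lambda>x. G (K 0 x)) = sphere_degree p (\<lambda>x. G (K 1 x))"
  proof (intro sphere_degree_homotopy[of p "\<lambda>t x. G (K t x)"])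
    fix t x assume tx: "t \<in> {0..1::real}" "x \<in> sph p"
    obtain i where i: "i \<le> p" "F x i \<noteq> 0" using F(2) tx by blast
    have s: "sqrt (\<Sum>j\<le>p. (F x j)\<^sup>2) > 0"
      using sum_squares_pos[of p "F x"] i by auto
    have "K t x i = ((1 - t) + t / sqrt (\<Sum>j\<le>p. (F x j)\<^sup>2)) * F x i"
      using i by (simp add: K_def unit_vec_def algebra_simps)
    moreover have "(1 - t) + t / sqrt (\<Sum>j\<le>p. (F x j)\<^sup>2) > 0"
      using tx s by (cases "t = 1") (auto intro!: add_pos_nonneg)
    ultimately have "K t x i \<noteq> 0" using i by auto
    then show "\<exists>i\<le>p. G (K t x) i \<noteq> 0" using G(2) i(1) by blast
  qed (rule continuous_on_compose2[OF G(1)], auto)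
  then have "sphere_degree p (\<lambda>x. G (F x)) = sphere_degree p (\<lambda>x. G (unit_vec p (F x)))"
    by (simp add: K_def)
  also have "\<dots> = Brouwer_degree2 p ((\<lambda>x. unit_vec p (G x)) \<circ> (\<lambda>x. unit_vec p (F x)))"
    by (simp add: sphere_degree_def o_def)
  also have "\<dots> = sphere_degree p G * sphere_degree p F"
    unfolding sphere_degree_def
  proof (rule Brouwer_degree2_compose)
    show "continuous_map (nsphere p) (nsphere p) (\<lambda>x. unit_vec p (F x))"
      using continuous_map_unit_vec[of p "sph p" F] Fc F(2) unfolding nsphere_eq by simp
    show "continuous_map (nsphere p) (nsphere p) (\<lambda>x. unit_vec p (G x))"
      using continuous_map_unit_vec[of p "sph p" G] continuous_on_subset[OF G(1)] G(2) sph_nonzero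
      unfolding nsphere_eq by simp
  qed
  finally show ?thesis .
qed

text \<open>The new coordinate is only divided by a nonnegative number, so both hemispheres are
  preserved.\<close>

lemma sphere_degree_suspension:
  assumes F: "\<And>i. i \<le> p \<Longrightarrow> continuous_on UNIV (\<lambda>x. F x i)" "\<And>x. x \<in> sph p \<Longrightarrow> \<exists>i\<le>p. F x i \<noteq> 0"
  shows "sphere_degree (Suc p) (\<lambda>x i. if i \<le> p then F x i else x i) = sphere_degree p F"
  unfolding sphere_degree_def
proof (rule Brouwer_degree2_suspension)
  let ?S = "\<lambda>x i. if i \<le> p then F x i else x i"
  have equator: "x \<in> sph p" if "x \<in> sph (Suc p)" "x (Suc p) = 0" for x
    using that by (auto simp: sph_def) (metis Suc_lessI)
  show "continuous_map (nsphere p) (nsphere p) (\<lambda>x. unit_vec p (F x))"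
    using continuous_map_unit_vec[of p "sph p" F] continuous_on_subset[OF F(1)] F(2) unfolding nsphere_eq by simp
  have nz: "\<exists>i\<le>Suc p. ?S x i \<noteq> 0" if x: "x \<in> sph (Suc p)" for x
  proof (cases "x (Suc p) = 0")
    case True
    then show ?thesis using F(2)[OF equator[OF x]] by (auto intro: le_SucI)
  qed (auto intro!: exI[of _ "Suc p"])
  have "continuous_on (sph (Suc p)) (\<lambda>x. ?S x i)" for i
    using F(1)[of i] by (cases "i \<le> p") (auto intro: continuous_on_subset[OF _ subset_UNIV])
  then show "continuous_map (nsphere (Suc p)) (nsphere (Suc p)) (\<lambda>x. unit_vec (Suc p) (?S x))"
    using continuous_map_unit_vec[of "Suc p" "sph (Suc p)" ?S] nz unfolding nsphere_eq by simp
  show "unit_vec (Suc p) (?S x) = unit_vec p (F x)" if "x \<in> topspace (nsphere p)" for x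
    using that by (auto simp: unit_vec_def sph_def fun_eq_iff le_Suc_eq)
  have last: "unit_vec (Suc p) (?S x) (Suc p) = x (Suc p) / sqrt (\<Sum>j\<le>Suc p. (?S x j)\<^sup>2)" for x
    by (simp add: unit_vec_def)
  have s: "sqrt (\<Sum>j\<le>Suc p. (?S x j)\<^sup>2) \<ge> 0" for x
    by (rule real_sqrt_ge_zero, rule sum_nonneg) simp
  show "0 \<le> unit_vec (Suc p) (?S x) (Suc p)" if "0 \<le> x (Suc p)" for x
    unfolding last by (rule divide_nonneg_nonneg[OF that s])
  show "unit_vec (Suc p) (?S x) (Suc p) \<le> 0" if "x (Suc p) \<le> 0" for x
    unfolding last by (rule divide_nonpos_nonneg[OF that s])
qed

section \<open>Degree of maps in complex coordinates\<close>

definition re_im :: "(nat \<Rightarrow> complex) \<Rightarrow> nat \<Rightarrow> real" where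
  "re_im w = (\<lambda>i. if even i then Re (w (i div 2)) else Im (w (i div 2)))"

definition of_re_im :: "(nat \<Rightarrow> real) \<Rightarrow> nat \<Rightarrow> complex" where
  "of_re_im x = (\<lambda>k. Complex (x (2 * k)) (x (2 * k + 1)))"

text \<open>The sphere in complex m-space has dimension 2 m - 1, which is meaningful only for m >
  0.\<close>

definition cdegree :: "nat \<Rightarrow> ((nat \<Rightarrow> complex) \<Rightarrow> nat \<Rightarrow> complex) \<Rightarrow> int" where
  "cdegree m F = sphere_degree (2 * m - 1) (\<lambda>x. re_im (F (of_re_im x)))"

lemma of_re_im_re_im [simp]: "of_re_im (re_im w) = w"
  by (simp add: of_re_im_def re_im_def)

lemma re_im_of_re_im [simp]: "re_im (of_re_im x) = x"
  by (auto simp: of_re_im_def re_im_def fun_eq_iff elim: evenE oddE)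

lemma continuous_on_re_im: "continuous_on S (\<lambda>z. F z (i div 2)) \<Longrightarrow> continuous_on S (\<lambda>z. re_im (F z) i)"
  unfolding re_im_def by (cases "even i") (auto intro!: continuous_intros)

lemma continuous_on_of_re_im: "continuous_on S of_re_im"
  unfolding of_re_im_def Complex_eq
  by (intro continuous_on_coordinatewise_then_product continuous_intros
        continuous_on_subset[OF continuous_on_product_coordinates]) auto

lemma re_im_nonzero_iff:
  assumes "m > 0"
  shows "(\<exists>i\<le>2 * m - 1. re_im w i \<noteq> 0) \<longleftrightarrow> (\<exists>k<m. w k \<noteq> 0)"
proof
  assume "\<exists>i\<le>2 * m - 1. re_im w i \<noteq> 0"
  then obtain i where "i \<le> 2 * m - 1" "re_im w i \<noteq> 0" by blast
  then show "\<exists>k<m. w k \<noteq> 0"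
    using assms by (intro exI[of _ "i div 2"]) (auto simp: re_im_def split: if_splits)
next
  assume "\<exists>k<m. w k \<noteq> 0"
  then obtain k where k: "k < m" "w k \<noteq> 0" by blast
  then have "re_im w (2 * k) \<noteq> 0 \<or> re_im w (2 * k + 1) \<noteq> 0"
    by (auto simp: re_im_def complex_eq_iff)
  moreover have "2 * k \<le> 2 * m - 1" "2 * k + 1 \<le> 2 * m - 1" using k by auto
  ultimately show "\<exists>i\<le>2 * m - 1. re_im w i \<noteq> 0" by blast
qed

lemma of_re_im_sph:
  assumes "m > 0" "x \<in> sph (2 * m - 1)"
  shows "of_re_im x \<in> csphere m"
proof -
  have "(\<Sum>i<2 * n. (x i)\<^sup>2) = (\<Sum>k<n. (cmod (of_re_im x k))\<^sup>2)" for n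
    by (induction n) (auto simp: of_re_im_def cmod_power2)
  moreover have "{..2 * m - 1} = {..<2 * m}" using assms by auto
  ultimately show ?thesis
    using assms by (auto simp: sph_def csphere_def of_re_im_def complex_eq_iff)
qed

lemma csphere_nonzero: "w \<in> csphere m \<Longrightarrow> \<exists>k<m. w k \<noteq> 0"
  by (rule ccontr) (auto simp: csphere_def)

lemma cdegree_homotopy:
  fixes H :: "real \<Rightarrow> (nat \<Rightarrow> complex) \<Rightarrow> nat \<Rightarrow> complex"
  assumes m: "m > 0"
    and "\<And>k. k < m \<Longrightarrow> continuous_on ({0..1} \<times> csphere m) (\<lambda>z. H (fst z) (snd z) k)"
    and "\<And>t w. t \<in> {0..1} \<Longrightarrow> w \<in> csphere m \<Longrightarrow> \<exists>k<m. H t w k \<noteq> 0"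
  shows "cdegree m (H 0) = cdegree m (H 1)"
  unfolding cdegree_def
proof (rule sphere_degree_homotopy[of _ "\<lambda>t x. re_im (H t (of_re_im x))"])
  fix i assume "i \<le> 2 * m - 1"
  then have "i div 2 < m" using m by auto
  then show "continuous_on ({0..1} \<times> sph (2 * m - 1)) (\<lambda>z. re_im (H (fst z) (of_re_im (snd z))) i)"
    using of_re_im_sph[OF m]
    by (intro continuous_on_re_im continuous_on_compose2[OF assms(2), of _ _ "\<lambda>z. (fst z, of_re_im (snd z))", simplified]
          continuous_intros continuous_on_compose2[OF continuous_on_of_re_im]) auto
qed (use assms of_re_im_sph re_im_nonzero_iff in metis)

lemma cdegree_cong:
  assumes "m > 0" "\<And>w k. w \<in> csphere m \<Longrightarrow> k < m \<Longrightarrow> F w k = G w k"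
  shows "cdegree m F = cdegree m G"
  unfolding cdegree_def
proof (rule sphere_degree_cong)
  fix x i assume "x \<in> sph (2 * m - 1)" "i \<le> 2 * m - 1"
  moreover have "i div 2 < m" using calculation assms by auto
  ultimately show "re_im (F (of_re_im x)) i = re_im (G (of_re_im x)) i"
    using assms of_re_im_sph by (simp add: re_im_def)
qed

lemma cdegree_const: "cdegree m (\<lambda>w. c) = 0"
  by (simp add: cdegree_def sphere_degree_const)

lemma cdegree_compose:
  assumes m: "m > 0"
    and F: "continuous_on UNIV F" "\<And>w. \<exists>k<m. w k \<noteq> 0 \<Longrightarrow> \<exists>k<m. F w k \<noteq> 0"
    and G: "continuous_on UNIV G" "\<And>w. \<exists>k<m. w k \<noteq> 0 \<Longrightarrow> \<exists>k<m. G w k \<noteq> 0"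
  shows "cdegree m (\<lambda>w. G (F w)) = cdegree m G * cdegree m F"
proof -
  have c: "continuous_on UNIV (\<lambda>x. re_im (H (of_re_im x)) i)" if "continuous_on UNIV H" for H :: "(nat \<Rightarrow> complex) \<Rightarrow> nat \<Rightarrow> complex" and i
    by (rule continuous_on_re_im, rule continuous_on_product_then_coordinatewise)
       (auto intro!: continuous_on_compose2[OF that] continuous_on_of_re_im)
  have nzF: "\<exists>i\<le>2*m-1. re_im (F (of_re_im x)) i \<noteq> 0" if "\<exists>i\<le>2*m-1. x i \<noteq> 0" for x
    using that F(2)[of "of_re_im x"] re_im_nonzero_iff[OF m] by (metis re_im_of_re_im)
  have nzG: "\<exists>i\<le>2*m-1. re_im (G (of_re_im x)) i \<noteq> 0" if "\<exists>i\<le>2*m-1. x i \<noteq> 0" for x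
    using that G(2)[of "of_re_im x"] re_im_nonzero_iff[OF m] by (metis re_im_of_re_im)
  have "sphere_degree (2*m-1) (\<lambda>x. (\<lambda>y. re_im (G (of_re_im y))) (re_im (F (of_re_im x))))
    = sphere_degree (2*m-1) (\<lambda>y. re_im (G (of_re_im y))) * sphere_degree (2*m-1) (\<lambda>x. re_im (F (of_re_im x)))"
  proof (rule sphere_degree_compose)
    show "continuous_on (sph (2*m-1)) (\<lambda>x. re_im (F (of_re_im x)))"
      by (rule continuous_on_coordinatewise_then_product, rule continuous_on_subset[OF c[OF F(1)]]) simp
  qed (use c[OF G(1)] nzF nzG sph_nonzero in blast)+
  then show ?thesis by (simp add: cdegree_def)
qed

text \<open>One more complex coordinate amounts to two real suspensions.\<close>

lemma cdegree_suspension: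
  assumes m: "m > 0"
    and F: "continuous_on UNIV F" "\<And>w. \<exists>k<m. w k \<noteq> 0 \<Longrightarrow> \<exists>k<m. F w k \<noteq> 0"
  shows "cdegree (Suc m) (\<lambda>w k. if k < m then F w k else w k) = cdegree m F"
proof -
  let ?F = "\<lambda>x. re_im (F (of_re_im x))" and ?p = "2 * m - 1"
  let ?G = "\<lambda>x i. if i \<le> ?p then ?F x i else x i"
  have c: "continuous_on UNIV (\<lambda>x. ?F x i)" for i
    by (rule continuous_on_re_im, rule continuous_on_product_then_coordinatewise)
       (auto intro!: continuous_on_compose2[OF F(1)] continuous_on_of_re_im)
  have nz: "\<exists>i\<le>?p. ?F x i \<noteq> 0" if "\<exists>i\<le>?p. x i \<noteq> 0" for x
    using that F(2) re_im_nonzero_iff[OF m] by (metis re_im_of_re_im)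
  have 1: "sphere_degree (Suc ?p) ?G = sphere_degree ?p ?F"
    by (rule sphere_degree_suspension) (use c nz sph_nonzero in auto)
  have "sphere_degree (Suc (Suc ?p)) (\<lambda>x i. if i \<le> Suc ?p then ?G x i else x i) = sphere_degree (Suc ?p) ?G"
  proof (rule sphere_degree_suspension)
    fix x assume x: "x \<in> sph (Suc ?p)"
    show "\<exists>i\<le>Suc ?p. ?G x i \<noteq> 0"
    proof (cases "\<exists>i\<le>?p. x i \<noteq> 0")
      case True
      then show ?thesis using nz[of x] by (metis le_SucI)
    next
      case False
      then have "x (Suc ?p) \<noteq> 0"
        using sph_nonzero[OF x] le_Suc_eq by metis
      then show ?thesis by (intro exI[of _ "Suc ?p"]) auto
    qed
  next
    show "continuous_on UNIV (\<lambda>x. ?G x i)" for i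
      using c by (cases "i \<le> ?p") auto
  qed
  moreover have "(\<lambda>x i. if i \<le> Suc ?p then ?G x i else x i) = (\<lambda>x. re_im (\<lambda>k. if k < m then F (of_re_im x) k else of_re_im x k))"
  proof (intro ext)
    fix x i
    have "i \<le> ?p \<longleftrightarrow> i div 2 < m" using m by auto
    moreover have "re_im (of_re_im x) i = x i" by simp
    ultimately show "(if i \<le> Suc ?p then ?G x i else x i) = re_im (\<lambda>k. if k < m then F (of_re_im x) k else of_re_im x k) i"
      by (auto simp: re_im_def)
  qed
  moreover have "Suc (Suc ?p) = 2 * Suc m - 1" using m by simp
  ultimately show ?thesis
    using 1 by (simp add: cdegree_def)
qed

lemma continuous_on_fun_upd_power: "continuous_on UNIV (\<lambda>w::nat \<Rightarrow> complex. w(i := w i ^ K))"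
proof (rule continuous_on_coordinatewise_then_product)
  show "continuous_on UNIV (\<lambda>w::nat \<Rightarrow> complex. (w(i := w i ^ K)) j)" for j
    by (cases "j = i") (auto intro!: continuous_intros)
qed

lemma fun_upd_power_nonzero:
  "K > 0 \<Longrightarrow> \<exists>k<m. w k \<noteq> (0::complex) \<Longrightarrow> \<exists>k<m. (w(i := w i ^ K)) k \<noteq> 0"
  by (metis fun_upd_other fun_upd_same power_not_zero)

text \<open>The power sits in coordinate 0 so that the later coordinates are all suspensions of the
  circle case.\<close>

lemma cdegree_power_first:
  assumes K: "K > 0"
  shows "cdegree (Suc m) (\<lambda>w. w(0 := w 0 ^ K)) \<noteq> 0"
proof (induction m)
  case 0
  let ?F = "\<lambda>x. unit_vec 1 (re_im ((of_re_im x)(0 := of_re_im x 0 ^ K)))"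
  have n1: "cmod (of_re_im x 0) = 1" if "x \<in> sph 1" for x
    using that by (auto simp: sph_def of_re_im_def cmod_def)
  have c: "continuous_on UNIV (\<lambda>x. re_im ((of_re_im x)(0 := of_re_im x 0 ^ K)) i)" for i
    by (rule continuous_on_re_im, rule continuous_on_product_then_coordinatewise)
       (rule continuous_on_compose2[OF continuous_on_fun_upd_power[of 0 K] continuous_on_of_re_im], simp)
  have "Brouwer_degree2 1 ?F \<noteq> 0"
  proof (rule degree_circle_power_nonzero[OF _ K])
    have "\<exists>i\<le>1. re_im ((of_re_im x)(0 := of_re_im x 0 ^ K)) i \<noteq> 0" if "x \<in> sph 1" for x
      using n1[OF that] re_im_nonzero_iff[of 1 "(of_re_im x)(0 := of_re_im x 0 ^ K)"] by auto
    then show "continuous_map (nsphere 1) (nsphere 1) ?F"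
      using continuous_map_unit_vec[of 1 "sph 1" "\<lambda>x. re_im ((of_re_im x)(0 := of_re_im x 0 ^ K))"]
        continuous_on_subset[OF c] by (subst (1) nsphere_eq) simp
  next
    fix x assume x: "x \<in> topspace (nsphere 1)"
    let ?y = "re_im ((of_re_im x)(0 := of_re_im x 0 ^ K))"
    have z: "Complex (?y 0) (?y 1) = of_re_im x 0 ^ K"
      by (simp add: re_im_def)
    have "(\<Sum>j\<le>1. (?y j)\<^sup>2) = (cmod (Complex (?y 0) (?y 1)))\<^sup>2"
      by (simp only: cmod_power2 complex.sel) simp
    also have "\<dots> = (cmod (of_re_im x 0 ^ K))\<^sup>2"
      by (simp only: z)
    also have "\<dots> = 1"
      using n1 x by (simp add: norm_power)
    finally have "?F x 0 = ?y 0" "?F x 1 = ?y 1"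
      by (simp_all only: unit_vec_def real_sqrt_one) simp_all
    then show "Complex (?F x 0) (?F x 1) = Complex (x 0) (x 1) ^ K"
      using z by (simp add: of_re_im_def)
  qed
  then show ?case by (simp add: cdegree_def sphere_degree_def fun_upd_def)
next
  case (Suc m)
  have "cdegree (Suc (Suc m)) (\<lambda>w k. if k < Suc m then (w(0 := w 0 ^ K)) k else w k) = cdegree (Suc m) (\<lambda>w. w(0 := w 0 ^ K))"
    by (rule cdegree_suspension[OF _ continuous_on_fun_upd_power fun_upd_power_nonzero[OF K]]) simp_all
  moreover have "(\<lambda>(w::nat \<Rightarrow> complex) k. if k < Suc m then (w(0 := w 0 ^ K)) k else w k) = (\<lambda>w. w(0 := w 0 ^ K))"
    by (auto simp: fun_eq_iff)
  ultimately show ?case using Suc by (simp add: fun_upd_def)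
qed

text \<open>Conjugation with the swap of coordinates 0 and m turns this map into the one of
  \<open>cdegree_power_first\<close>. By multiplicativity its degree is a factor of a nonzero
  integer.\<close>

lemma cdegree_power_last:
  assumes K: "K > 0"
  shows "cdegree (Suc m) (\<lambda>w. w(m := w m ^ K)) \<noteq> 0"
proof -
  define s where "s w = w \<circ> Transposition.transpose 0 m" for w :: "nat \<Rightarrow> complex"
  let ?D = "\<lambda>(w::nat \<Rightarrow> complex). w(m := w m ^ K)"
  have sc: "continuous_on UNIV s"
    unfolding s_def o_def by (intro continuous_on_coordinatewise_then_product) simp
  have sn: "\<exists>k<Suc m. s w k \<noteq> 0" if w: "\<exists>k<Suc m. w k \<noteq> 0" for w
  proof -
    obtain k where k: "k < Suc m" "w k \<noteq> 0" using w by blast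
    have "Transposition.transpose 0 m k < Suc m"
      using k(1) by (simp add: Transposition.transpose_def)
    moreover have "s w (Transposition.transpose 0 m k) \<noteq> 0"
      using k(2) by (simp add: s_def)
    ultimately show ?thesis by blast
  qed
  have Dn: "\<exists>k<Suc m. ?D w k \<noteq> 0" if "\<exists>k<Suc m. w k \<noteq> 0" for w
    by (rule fun_upd_power_nonzero[OF K that])
  have Ds: "continuous_on UNIV (\<lambda>w. ?D (s w))"
    by (rule continuous_on_compose2[OF continuous_on_fun_upd_power sc]) simp
  have "cdegree (Suc m) (\<lambda>w. s (?D (s w))) = cdegree (Suc m) s * cdegree (Suc m) (\<lambda>w. ?D (s w))"
    by (rule cdegree_compose[OF _ Ds Dn[OF sn] sc sn]) simp_all
  also have "cdegree (Suc m) (\<lambda>w. ?D (s w)) = cdegree (Suc m) ?D * cdegree (Suc m) s"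
    by (rule cdegree_compose[OF _ sc sn continuous_on_fun_upd_power Dn]) simp_all
  also have "(\<lambda>w. s (?D (s w))) = (\<lambda>w. w(0 := w 0 ^ K))"
    by (auto simp: fun_eq_iff s_def Transposition.transpose_def)
  finally show ?thesis
    using cdegree_power_first[OF K, of m] by (auto simp: fun_upd_def)
qed

subsection \<open>The elementary symmetric functions\<close>

lemma coeff_linear_mult:
  "poly.coeff ([:a, b:] * p) j = a * poly.coeff p j + b * (case j of 0 \<Rightarrow> 0 | Suc i \<Rightarrow> poly.coeff p i)"
  for a b :: "'a::comm_semiring_1"
  by (cases j) simp_all

lemma continuous_on_coeff_prod_linear:
  fixes v x :: "'z::topological_space \<Rightarrow> 'k \<Rightarrow> complex"
  assumes "finite S" "\<And>k. k \<in> S \<Longrightarrow> continuous_on X (\<lambda>z. v z k)" "\<And>k. k \<in> S \<Longrightarrow> continuous_on X (\<lambda>z. x z k)"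
  shows "continuous_on X (\<lambda>z. poly.coeff (\<Prod>k\<in>S. [:v z k, x z k:]) j)"
  using assms
proof (induction S arbitrary: j)
  case (insert k S)
  have "continuous_on X (\<lambda>z. case j of 0 \<Rightarrow> 0 | Suc i \<Rightarrow> poly.coeff (\<Prod>k\<in>S. [:v z k, x z k:]) i)"
    using insert by (cases j) auto
  then have "continuous_on X (\<lambda>z. poly.coeff ([:v z k, x z k:] * (\<Prod>k\<in>S. [:v z k, x z k:])) j)"
    unfolding coeff_linear_mult using insert by (intro continuous_intros) auto
  then show ?case using insert by simp
qed simp

text \<open>The product is a nonzero polynomial whose degree is the sum of the degrees of its
  factors, hence between 1 and m; its leading coefficient is the witness.\<close>

lemma prod_linear_coeff_nonzero:
  fixes v x :: "nat \<Rightarrow> complex"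
  assumes "\<And>k. k < m \<Longrightarrow> v k \<noteq> 0 \<or> x k \<noteq> 0" "\<exists>k<m. x k \<noteq> 0"
  shows "\<exists>j<m. poly.coeff (\<Prod>k<m. [:v k, x k:]) (Suc j) \<noteq> 0"
proof -
  let ?q = "\<Prod>k<m. [:v k, x k:]"
  have d: "Polynomial.degree ?q = (\<Sum>k<m. Polynomial.degree [:v k, x k:])"
    by (rule degree_prod_eq_sum_degree) (use assms(1) in auto)
  obtain k where k: "k < m" "x k \<noteq> 0" using assms(2) by blast
  have "Polynomial.degree [:v k, x k:] \<le> Polynomial.degree ?q"
    unfolding d using k by (intro member_le_sum) auto
  then have "Polynomial.degree ?q > 0" using k by simp
  moreover have "Polynomial.degree ?q \<le> (\<Sum>k<m. 1)"
    unfolding d by (rule sum_mono) simp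
  moreover have "?q \<noteq> 0" using assms(1) by simp
  then have "poly.coeff ?q (Polynomial.degree ?q) \<noteq> 0" by simp
  ultimately show ?thesis
    by (intro exI[of _ "Polynomial.degree ?q - 1"]) auto
qed

text \<open>For \<open>v\<close> = 1 these are the elementary symmetric functions of the
  \<open>w k ^ b k\<close>. The omitted constant coefficient is the product of the
  \<open>v k\<close>; for \<open>v k\<close> = 1 - |w k| it vanishes on the boundary of the
  polydisc.\<close>

definition sym_map :: "nat \<Rightarrow> (nat \<Rightarrow> nat) \<Rightarrow> (nat \<Rightarrow> complex) \<Rightarrow> (nat \<Rightarrow> complex) \<Rightarrow> nat \<Rightarrow> complex" where
  "sym_map m b v w = (\<lambda>j. if j < m then poly.coeff (\<Prod>k<m. [:v k, w k ^ b k:]) (Suc j) else 0)"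

lemma continuous_on_sym_map:
  fixes v w :: "'z::topological_space \<Rightarrow> nat \<Rightarrow> complex"
  assumes "\<And>k. k < m \<Longrightarrow> continuous_on X (\<lambda>z. v z k)" "\<And>k. k < m \<Longrightarrow> continuous_on X (\<lambda>z. w z k)"
  shows "continuous_on X (\<lambda>z. sym_map m b (v z) (w z) j)"
  unfolding sym_map_def using assms
  by (cases "j < m") (auto intro!: continuous_on_coeff_prod_linear continuous_intros)

lemma sym_map_nonzero:
  assumes "\<And>k. k < m \<Longrightarrow> b k > 0" "\<And>k. k < m \<Longrightarrow> v k \<noteq> 0 \<or> w k \<noteq> 0" "\<exists>k<m. w k \<noteq> 0"
  shows "\<exists>j<m. sym_map m b v w j \<noteq> 0"
  using prod_linear_coeff_nonzero[of m v "\<lambda>k. w k ^ b k"] assms by (auto simp: sym_map_def)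

text \<open>Up to homotopy, the map in m + 1 variables is the suspension of the map in m variables
  followed by the power b m * (m + 1) in the last coordinate. Iterating this is the origin of m!
  times the product of the b k.\<close>

lemma cdegree_sym_map_step:
  assumes m: "m > 0" and b: "\<And>k. b k > 0" and deg: "cdegree m (sym_map m b (\<lambda>_. 1)) \<noteq> 0"
  shows "cdegree (Suc m) (sym_map (Suc m) b (\<lambda>_. 1)) \<noteq> 0"
proof -
  let ?P = "sym_map m b (\<lambda>_. 1)"
  define c where "c w = poly.coeff (\<Prod>k<m. [:1, w k ^ b k:])" for w :: "nat \<Rightarrow> complex"
  define x where "x w = w m ^ b m" for w :: "nat \<Rightarrow> complex"
  have c0: "c w 0 = 1" for w
    unfolding c_def by (induction m) (simp_all add: coeff_mult_0)
  have cS: "c w (Suc m) = 0" for w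
  proof -
    have "Polynomial.degree (\<Prod>k<m. [:1, w k ^ b k:]) \<le> (\<Sum>k<m. Polynomial.degree [:1, w k ^ b k:])"
      using degree_prod_sum_le[of "{..<m}" "\<lambda>k. [:1, w k ^ b k:]"] by (simp add: o_def)
    also have "\<dots> \<le> (\<Sum>k<m. 1)" by (rule sum_mono) simp
    finally show ?thesis unfolding c_def by (simp add: coeff_eq_0)
  qed
  have cc: "continuous_on X (\<lambda>w. c w j)" for X j
    unfolding c_def
    by (intro continuous_on_coeff_prod_linear continuous_intros continuous_on_subset[OF continuous_on_product_coordinates]) auto
  have xc: "continuous_on X x" for X
    unfolding x_def by (intro continuous_intros continuous_on_subset[OF continuous_on_product_coordinates]) auto
  have vanish: "w k = 0" if "\<And>j. j < m \<Longrightarrow> c w (Suc j) = 0" "k < m" for w k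
  proof (rule ccontr)
    assume "w k \<noteq> 0"
    then have "\<exists>j<m. sym_map m b (\<lambda>_. 1) w j \<noteq> 0"
      using that(2) b by (intro sym_map_nonzero) auto
    then show False using that(1) by (auto simp: sym_map_def c_def)
  qed
  have cs: "continuous_on ({0..1::real} \<times> S) (\<lambda>z. c (snd z) j)" "continuous_on ({0..1::real} \<times> S) (\<lambda>z. x (snd z))"
    for S j
    by (rule continuous_on_compose2[OF cc continuous_on_snd[OF continuous_on_id] subset_UNIV])
       (rule continuous_on_compose2[OF xc continuous_on_snd[OF continuous_on_id] subset_UNIV])
  (* the factor 1 + x T multiplies c by a shear, which H undoes while keeping the zero set at 0 *)
  define H where "H t w j = (if j < m then c w (Suc j) + of_real (1 - t) * x w * c w j
     else of_real (1 - t) * x w * c w m + of_real t * (- 1) ^ m * x w ^ Suc m)" for t w j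
  have "cdegree (Suc m) (H 0) = cdegree (Suc m) (H 1)"
  proof (rule cdegree_homotopy)
    show "continuous_on ({0..1} \<times> csphere (Suc m)) (\<lambda>z. H (fst z) (snd z) k)" for k
      unfolding H_def by (cases "k < m") (auto intro!: continuous_intros cs)
    show "\<exists>k<Suc m. H t w k \<noteq> 0" if t: "t \<in> {0..1}" and w: "w \<in> csphere (Suc m)" for t w
    proof (rule ccontr)
      assume "\<not> ?thesis"
      then have z: "H t w k = 0" if "k < Suc m" for k using that by blast
      \<comment> \<open>If the first m coordinates vanish, \<open>c\<close> is a geometric
        progression with ratio -(1 - t) x. The last coordinate then equals (-1)^m x^(m+1) times (1 -
        t)^(m+1) + t > 0; the sign in \<open>H\<close> is there to prevent cancellation.\<close>
      have ck: "c w k = (- of_real (1 - t) * x w) ^ k" if "k \<le> m" for k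
        using that
      proof (induction k)
        case (Suc k)
        then have "c w (Suc k) = - of_real (1 - t) * x w * c w k"
          using z[of k] by (simp add: H_def algebra_simps eq_neg_iff_add_eq_0)
        with Suc show ?case by simp
      qed (simp add: c0)
      have "0 = of_real (1 - t) * x w * (- of_real (1 - t) * x w) ^ m + of_real t * (- 1) ^ m * x w ^ Suc m"
        using z[of m] ck[of m] by (simp add: H_def)
      also have "\<dots> = (- 1) ^ m * x w ^ Suc m * of_real ((1 - t) ^ Suc m + t)"
      proof -
        have "y * X * (- y * X) ^ m + s * (- 1) ^ m * X ^ Suc m = (- 1) ^ m * X ^ Suc m * (y ^ Suc m + s)" for y X s :: complex
          unfolding power_mult_distrib power_minus[of y] by (simp add: algebra_simps)
        from this[of "of_real (1 - t)" "x w" "of_real t"] show ?thesis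
          by (simp only: of_real_add of_real_power)
      qed
      finally have "x w = 0 \<or> (1 - t) ^ Suc m + t = 0"
        by (auto simp del: of_real_add of_real_power of_real_diff)
      moreover have "(1 - t) ^ Suc m + t > 0"
        using t by (cases "t = 0") (auto intro!: add_nonneg_pos)
      ultimately have x0: "x w = 0" by simp
      then have "w m = 0" by (simp add: x_def)
      moreover have "c w (Suc j) = 0" if "j < m" for j
        using z[of j] that x0 by (simp add: H_def)
      then have "w k = 0" if "k < m" for k
        using vanish[OF _ that] by blast
      ultimately show False
        using csphere_nonzero[OF w] less_Suc_eq by auto
    qed
  qed simp
  also have "cdegree (Suc m) (H 0) = cdegree (Suc m) (sym_map (Suc m) b (\<lambda>_. 1))"
  proof (rule cdegree_cong)
    fix w k assume k: "k < Suc m"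
    have "(\<Prod>k<Suc m. [:1, w k ^ b k:]) = [:1, x w:] * (\<Prod>k<m. [:1, w k ^ b k:])"
      by (simp add: x_def mult.commute)
    then have "sym_map (Suc m) b (\<lambda>_. 1) w k = c w (Suc k) + x w * c w k"
      using k unfolding sym_map_def by (simp only: if_True coeff_linear_mult) (simp add: c_def)
    then show "H 0 w k = sym_map (Suc m) b (\<lambda>_. 1) w k"
      using k cS by (auto simp: H_def less_Suc_eq)
  qed simp
  finally have 1: "cdegree (Suc m) (sym_map (Suc m) b (\<lambda>_. 1)) = cdegree (Suc m) (H 1)" by simp
  \<comment> \<open>A rotation by the angle pi m (1 - t) removes the sign (-1)^m.\<close>
  define I where "I t w j = (if j < m then c w (Suc j) else cis (pi * real m * (1 - t)) * x w ^ Suc m)" for t w j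
  have "cdegree (Suc m) (I 0) = cdegree (Suc m) (I 1)"
  proof (rule cdegree_homotopy)
    show "continuous_on ({0..1} \<times> csphere (Suc m)) (\<lambda>z. I (fst z) (snd z) k)" for k
      unfolding I_def cis_conv_exp by (cases "k < m") (auto intro!: continuous_intros cs)
    show "\<exists>k<Suc m. I t w k \<noteq> 0" if w: "w \<in> csphere (Suc m)" for t w
    proof (rule ccontr)
      assume "\<not> ?thesis"
      then have z: "I t w k = 0" if "k < Suc m" for k using that by blast
      have "w m = 0" using z[of m] by (auto simp: I_def x_def)
      moreover have "c w (Suc j) = 0" if "j < m" for j
        using z[of j] that by (simp add: I_def)
      then have "w k = 0" if "k < m" for k
        using vanish[OF _ that] by blast
      ultimately show False
        using csphere_nonzero[OF w] less_Suc_eq by auto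
    qed
  qed simp
  moreover have "cdegree (Suc m) (I 0) = cdegree (Suc m) (H 1)"
  proof (rule cdegree_cong)
    have "cis (pi * real m) = (- 1) ^ m"
      using Complex.DeMoivre[of pi m] by (simp only: cis_pi mult.commute)
    then show "I 0 w k = H 1 w k" if "k < Suc m" for w k
      using that by (auto simp: I_def H_def less_Suc_eq)
  qed simp
  ultimately have 2: "cdegree (Suc m) (H 1) = cdegree (Suc m) (I 1)" by simp
  \<comment> \<open>\<open>x w\<close> is already the power b m of w m, so its power m + 1 has this
    exponent.\<close>
  define K where "K = b m * Suc m"
  define F where "F w = (\<lambda>k. if k < m then ?P w k else w k)" for w
  have "K > 0" using b by (simp add: K_def)
  have Pc: "continuous_on UNIV ?P"
    by (intro continuous_on_coordinatewise_then_product continuous_on_sym_map) auto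
  have Pn: "\<exists>k<m. ?P w k \<noteq> 0" if "\<exists>k<m. w k \<noteq> 0" for w
    using that b by (intro sym_map_nonzero) auto
  have Fc: "continuous_on UNIV F"
  proof (rule continuous_on_coordinatewise_then_product)
    show "continuous_on UNIV (\<lambda>w. F w k)" for k
      unfolding F_def using continuous_on_product_then_coordinatewise[OF Pc] by (cases "k < m") auto
  qed
  have Fn: "\<exists>k<Suc m. F w k \<noteq> 0" if "\<exists>k<Suc m. w k \<noteq> 0" for w
  proof (cases "\<exists>k<m. w k \<noteq> 0")
    case True
    then show ?thesis using Pn[OF True] by (auto simp: F_def intro: less_SucI)
  next
    case False
    then have "w m \<noteq> 0" using that less_Suc_eq by auto
    then show ?thesis by (auto simp: F_def)
  qed
  have "cdegree (Suc m) (I 1) = cdegree (Suc m) (\<lambda>w. (F w)(m := F w m ^ K))"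
    by (rule cdegree_cong) (auto simp: I_def F_def sym_map_def c_def x_def K_def less_Suc_eq power_add simp flip: power_mult)
  also have "\<dots> = cdegree (Suc m) (\<lambda>w. w(m := w m ^ K)) * cdegree (Suc m) F"
    by (rule cdegree_compose[OF _ Fc Fn continuous_on_fun_upd_power fun_upd_power_nonzero[OF \<open>K > 0\<close>]]) simp_all
  also have "cdegree (Suc m) F = cdegree m ?P"
    unfolding F_def by (rule cdegree_suspension[OF m Pc Pn])
  finally show ?thesis
    unfolding 1 2 using deg cdegree_power_last[OF \<open>K > 0\<close>, of m] by (auto simp: fun_upd_def)
qed

lemma cdegree_sym_map:
  assumes "m > 0" "\<And>k. b k > 0"
  shows "cdegree m (sym_map m b (\<lambda>_. 1)) \<noteq> 0"
  using assms(1)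
proof (induction m rule: nat_induct_non_zero)
  case 1
  have "cdegree 1 (sym_map 1 b (\<lambda>_. 1)) = cdegree 1 (\<lambda>w. w(0 := w 0 ^ b 0))"
    by (rule cdegree_cong) (auto simp: sym_map_def)
  then show ?case using cdegree_power_first[of "b 0" 0] assms(2) by (simp add: fun_upd_def)
next
  case (Suc m)
  then show ?case using cdegree_sym_map_step assms(2) by blast
qed

section \<open>Degree on the boundary of the polydisc\<close>

definition polydisc :: "nat \<Rightarrow> (nat \<Rightarrow> complex) set" where
  "polydisc m = {w. (\<forall>k<m. cmod (w k) \<le> 1) \<and> (\<forall>k\<ge>m. w k = 0)}"

definition polydisc_bd :: "nat \<Rightarrow> (nat \<Rightarrow> complex) set" where
  "polydisc_bd m = {w \<in> polydisc m. \<exists>k<m. cmod (w k) = 1}"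

text \<open>On m coordinates, the norm with the polydisc as unit ball; dividing by it carries the
  unit sphere radially to the polydisc boundary.\<close>

primrec max_cmod :: "nat \<Rightarrow> (nat \<Rightarrow> complex) \<Rightarrow> real" where
  "max_cmod 0 w = 0"
| "max_cmod (Suc m) w = max (max_cmod m w) (cmod (w m))"

lemma cmod_le_max_cmod: "k < m \<Longrightarrow> cmod (w k) \<le> max_cmod m w"
  by (induction m) (auto simp: less_Suc_eq max_def)

lemma max_cmod_attained: "max_cmod m w > 0 \<Longrightarrow> \<exists>k<m. cmod (w k) = max_cmod m w"
  by (induction m) (auto simp: max_def less_Suc_eq split: if_splits)

lemma continuous_on_max_cmod: "continuous_on X (max_cmod m)"
  by (induction m) (auto intro!: continuous_intros continuous_on_subset[OF continuous_on_product_coordinates])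

text \<open>Pulled back along the radial map \<open>rad\<close>, the family \<open>\<psi>\<close>
  joins \<open>G\<close> to the model map. The model has the nonzero degree of the symmetric
  functions, whereas \<open>G\<close> can be contracted to a constant inside the polydisc.\<close>

theorem no_nonvanishing_extension:
  fixes \<psi> :: "real \<Rightarrow> (nat \<Rightarrow> complex) \<Rightarrow> nat \<Rightarrow> complex"
  assumes m: "m > 0" and b: "\<And>k. b k > 0"
    and G: "\<And>j. j < m \<Longrightarrow> continuous_on (polydisc m) (\<lambda>w. G w j)" "\<And>w. w \<in> polydisc m \<Longrightarrow> \<exists>j<m. G w j \<noteq> 0"
    and \<psi>: "\<And>j. j < m \<Longrightarrow> continuous_on ({0..1} \<times> polydisc_bd m) (\<lambda>z. \<psi> (fst z) (snd z) j)"
      "\<And>t w. t \<in> {0..1} \<Longrightarrow> w \<in> polydisc_bd m \<Longrightarrow> \<exists>j<m. \<psi> t w j \<noteq> 0"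
    and \<psi>0: "\<And>w j. w \<in> polydisc_bd m \<Longrightarrow> j < m \<Longrightarrow> \<psi> 0 w j = G w j"
    and \<psi>1: "\<And>w j. w \<in> polydisc_bd m \<Longrightarrow> j < m \<Longrightarrow> \<psi> 1 w j = sym_map m b (\<lambda>k. of_real (1 - cmod (w k))) w j"
  shows False
proof -
  let ?M = "max_cmod m"
  define rad where "rad w = (\<lambda>k. w k / of_real (?M w))" for w
  have M: "?M w > 0" if "w \<in> csphere m" for w
    using csphere_nonzero[OF that] cmod_le_max_cmod[of _ m w] by (metis less_le_trans zero_less_norm_iff)
  have M': "?M w \<noteq> 0" if "w \<in> csphere m" for w
    using M[OF that] by simp
  have rad: "rad w \<in> polydisc_bd m" if w: "w \<in> csphere m" for w
  proof -
    have "cmod (rad w k) \<le> 1" if "k < m" for k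
      using M[OF w] cmod_le_max_cmod[OF that, of w] by (simp add: rad_def norm_divide)
    moreover have "\<exists>k<m. cmod (rad w k) = 1"
      using max_cmod_attained[OF M[OF w]] M[OF w] by (auto simp: rad_def norm_divide)
    ultimately show ?thesis
      using w by (auto simp: polydisc_bd_def polydisc_def rad_def csphere_def)
  qed
  have radn: "\<exists>k<m. rad w k \<noteq> 0" if "w \<in> csphere m" for w
    using rad[OF that] by (force simp: polydisc_bd_def)
  have sc: "continuous_on ({0..1::real} \<times> csphere m) (\<lambda>z. snd z k)" for k
    by (rule continuous_on_product_then_coordinatewise[OF continuous_on_snd[OF continuous_on_id]])
  have Mc: "continuous_on ({0..1::real} \<times> csphere m) (\<lambda>z. ?M (snd z))"
    by (rule continuous_on_compose2[OF continuous_on_max_cmod continuous_on_snd[OF continuous_on_id] subset_UNIV])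
  have rc: "continuous_on ({0..1::real} \<times> csphere m) (\<lambda>z. rad (snd z) k)" for k
    unfolding rad_def by (intro continuous_intros sc Mc) (auto simp: M')
  have rc': "continuous_on ({0..1::real} \<times> csphere m) (\<lambda>z. rad (snd z))"
    by (intro continuous_on_coordinatewise_then_product rc)
  let ?one = "\<lambda>_::nat. 1::complex"
  have "cdegree m (sym_map m b ?one) = cdegree m (\<lambda>w. sym_map m b ?one (rad w))"
  proof -
    \<comment> \<open>\<open>rad w\<close> is a positive multiple of w, so this segment runs along a
      ray and avoids 0.\<close>
    let ?H = "\<lambda>t w. sym_map m b ?one (\<lambda>k. of_real (1 - t + t / ?M w) * w k)"
    have "cdegree m (?H 0) = cdegree m (?H 1)"
    proof (rule cdegree_homotopy[OF m])
      show "continuous_on ({0..1} \<times> csphere m) (\<lambda>z. ?H (fst z) (snd z) k)" for k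
        by (intro continuous_on_sym_map continuous_intros sc Mc) (auto simp: M')
      show "\<exists>k<m. ?H t w k \<noteq> 0" if t: "t \<in> {0..1}" and w: "w \<in> csphere m" for t w
      proof (rule sym_map_nonzero)
        have "1 - t + t / ?M w > 0"
          using t M[OF w] by (cases "t = 1") (auto intro!: add_pos_nonneg)
        then have "of_real (1 - t + t / ?M w) \<noteq> (0::complex)"
          unfolding of_real_eq_0_iff by simp
        then show "\<exists>k<m. of_real (1 - t + t / ?M w) * w k \<noteq> 0"
          using csphere_nonzero[OF w] by simp
      qed (use b in auto)
    qed
    then show ?thesis by (simp add: rad_def)
  qed
  also have "\<dots> = cdegree m (\<lambda>w. sym_map m b (\<lambda>k. of_real (1 - cmod (rad w k))) (rad w))"
  proof -
    \<comment> \<open>No linear factor becomes zero on the way: where \<open>rad w k\<close> = 0,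
      its constant term is 1.\<close>
    let ?H = "\<lambda>t w. sym_map m b (\<lambda>k. of_real (1 - t * cmod (rad w k))) (rad w)"
    have "cdegree m (?H 0) = cdegree m (?H 1)"
    proof (rule cdegree_homotopy[OF m])
      show "continuous_on ({0..1} \<times> csphere m) (\<lambda>z. ?H (fst z) (snd z) k)" for k
        by (intro continuous_on_sym_map continuous_intros rc)
      show "\<exists>k<m. ?H t w k \<noteq> 0" if t: "t \<in> {0..1}" and w: "w \<in> csphere m" for t w
      proof (rule sym_map_nonzero)
        show "of_real (1 - t * cmod (rad w k)) \<noteq> (0::complex) \<or> rad w k \<noteq> 0" for k
          by (cases "rad w k = 0") auto
      qed (use b radn[OF w] in auto)
    qed
    then show ?thesis by simp
  qed
  also have "\<dots> = cdegree m (\<lambda>w. \<psi> 1 (rad w))"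
    by (rule cdegree_cong[OF m]) (use \<psi>1 rad in simp)
  also have "\<dots> = cdegree m (\<lambda>w. \<psi> 0 (rad w))"
  proof -
    let ?H = "\<lambda>t w. \<psi> (1 - t) (rad w)"
    have "cdegree m (?H 0) = cdegree m (?H 1)"
    proof (rule cdegree_homotopy[OF m])
      show "continuous_on ({0..1} \<times> csphere m) (\<lambda>z. ?H (fst z) (snd z) k)" if "k < m" for k
        by (rule continuous_on_compose2[OF \<psi>(1)[OF that], of _ "\<lambda>z. (1 - fst z, rad (snd z))", simplified])
           (use rad in \<open>auto intro!: continuous_intros rc'\<close>)
    qed (use \<psi>(2) rad in auto)
    then show ?thesis by simp
  qed
  also have "\<dots> = cdegree m (\<lambda>w. G (rad w))"
    by (rule cdegree_cong[OF m]) (use \<psi>0 rad in simp)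
  also have "\<dots> = cdegree m (\<lambda>w. G (\<lambda>k. 0))"
  proof -
    \<comment> \<open>Shrinking towards the centre stays in the polydisc, where \<open>G\<close> has
      no zeros.\<close>
    let ?s = "\<lambda>t w k. of_real (1 - t) * rad w k"
    let ?H = "\<lambda>t w. G (?s t w)"
    have s: "?s t w \<in> polydisc m" if "t \<in> {0..1}" "w \<in> csphere m" for t w
      using rad[OF that(2)] that(1) by (auto simp: polydisc_bd_def polydisc_def norm_mult mult_le_one simp del: of_real_diff)
    have "cdegree m (?H 0) = cdegree m (?H 1)"
    proof (rule cdegree_homotopy[OF m])
      show "continuous_on ({0..1} \<times> csphere m) (\<lambda>z. ?H (fst z) (snd z) k)" if "k < m" for k
        by (rule continuous_on_compose2[OF G(1)[OF that]])
           (use s in \<open>auto intro!: continuous_on_coordinatewise_then_product continuous_intros rc\<close>)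
    qed (use G(2) s in auto)
    then show ?thesis by simp
  qed
  also have "\<dots> = 0" by (rule cdegree_const)
  finally show False
    using cdegree_sym_map[OF m b] by simp
qed

subsection \<open>Extending nonvanishing maps from closed subsets\<close>

text \<open>Distance is measured by the finitely many coordinates \<open>c i\<close> rather than by
  the metric of the space, so that \<open>card D\<close> acts as the dimension.\<close>

definition sum_Lipschitz :: "'i set \<Rightarrow> ('i \<Rightarrow> 'a \<Rightarrow> real) \<Rightarrow> 'a set \<Rightarrow> ('a \<Rightarrow> real) \<Rightarrow> bool" where
  "sum_Lipschitz D c Z f \<longleftrightarrow> (\<exists>L\<ge>0. \<forall>y\<in>Z. \<forall>z\<in>Z. \<bar>f y - f z\<bar> \<le> L * (\<Sum>i\<in>D. \<bar>c i y - c i z\<bar>))"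

text \<open>
  Pigeonhole: a grid of spacing \<open>\<epsilon> / Q\<close> has \<open>Q ^ card T\<close> points, while their preimages would lie in
  \<open>O(Q ^ card D)\<close> cubes on each of which \<open>\<Psi>\<close> varies by less than the spacing.
\<close>

lemma sum_Lipschitz_missed_value:
  fixes c :: "'i \<Rightarrow> 'a \<Rightarrow> real" and \<Psi> :: "'t \<Rightarrow> 'a \<Rightarrow> real"
  assumes fin: "finite D" "finite T" and card: "card D < card T" and \<epsilon>: "\<epsilon> > 0"
    and c: "\<And>i z. i \<in> D \<Longrightarrow> z \<in> Z \<Longrightarrow> \<bar>c i z\<bar> \<le> 1"
    and lip: "\<And>j. j \<in> T \<Longrightarrow> sum_Lipschitz D c Z (\<Psi> j)"
  shows "\<exists>a. (\<forall>j\<in>T. \<bar>a j\<bar> < \<epsilon>) \<and> (\<forall>z\<in>Z. \<exists>j\<in>T. \<Psi> j z \<noteq> a j)"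
proof (rule ccontr)
  assume *: "\<not> ?thesis"
  then have hit: "\<exists>z\<in>Z. \<forall>j\<in>T. \<Psi> j z = a j" if "\<And>j. j \<in> T \<Longrightarrow> \<bar>a j\<bar> < \<epsilon>" for a
    using * that by blast
  obtain L0 where L0: "\<And>j. j \<in> T \<Longrightarrow> L0 j \<ge> 0"
    "\<And>j y z. j \<in> T \<Longrightarrow> y \<in> Z \<Longrightarrow> z \<in> Z \<Longrightarrow> \<bar>\<Psi> j y - \<Psi> j z\<bar> \<le> L0 j * (\<Sum>i\<in>D. \<bar>c i y - c i z\<bar>)"
    using lip unfolding sum_Lipschitz_def by metis
  define L where "L = (\<Sum>j\<in>T. L0 j)"
  have L: "L \<ge> 0" "\<And>j. j \<in> T \<Longrightarrow> L0 j \<le> L"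
    unfolding L_def using L0 fin by (auto intro: sum_nonneg member_le_sum)
  define d where "d = card D"
  \<comment> \<open>For every Q, cubes of side 1 / (Q M) give oscillation at most L d / (Q M) <
    \<epsilon> / Q. Only then is Q taken above (3 M)^d, which makes the at most (3 M)^d Q^d cubes
    fewer than Q^(d+1).\<close>
  obtain M :: nat where M: "M > 0" "L * real d / \<epsilon> < real M"
    using reals_Archimedean2[of "L * real d / \<epsilon>"] by (metis gr0I less_le_trans not_less of_nat_0 of_nat_0_le_iff le_less_trans divide_nonneg_pos mult_nonneg_nonneg L(1) \<epsilon>)
  define Q where "Q = Suc ((3 * M) ^ d)"
  have Q: "real Q > 0"
    unfolding of_nat_0_less_iff by (simp add: Q_def)
  define K where "K = Q * M"
  have K: "K > 0" "real K = real Q * real M"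
    using M unfolding K_def of_nat_mult by (simp_all add: Q_def)
  define pt where "pt g = (\<lambda>j. \<epsilon> * real (g j) / real Q)" for g :: "'t \<Rightarrow> nat"
  let ?G = "PiE T (\<lambda>_. {..<Q})"
  have "\<exists>z\<in>Z. \<forall>j\<in>T. \<Psi> j z = pt g j" if g: "g \<in> ?G" for g
  proof (rule hit)
    fix j assume "j \<in> T"
    then have "real (g j) < real Q" using g by (auto simp: PiE_iff)
    then show "\<bar>pt g j\<bar> < \<epsilon>"
      using \<epsilon> by (simp add: pt_def divide_less_eq)
  qed
  then obtain zz where zz: "\<And>g. g \<in> ?G \<Longrightarrow> zz g \<in> Z" "\<And>g j. g \<in> ?G \<Longrightarrow> j \<in> T \<Longrightarrow> \<Psi> j (zz g) = pt g j"
    by metis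
  define cell where "cell g = restrict (\<lambda>i. \<lfloor>c i (zz g) * real K\<rfloor>) D" for g
  let ?C = "PiE D (\<lambda>_. {- int K..int K})"
  have "cell g \<in> ?C" if g: "g \<in> ?G" for g
  proof -
    have "\<lfloor>c i (zz g) * real K\<rfloor> \<in> {- int K..int K}" if "i \<in> D" for i
    proof -
      have "\<bar>c i (zz g)\<bar> * real K \<le> 1 * real K"
        using c[OF that zz(1)[OF g]] by (intro mult_right_mono) auto
      then have "\<bar>c i (zz g) * real K\<bar> \<le> real K"
        by (simp add: abs_mult)
      then have "- real K \<le> c i (zz g) * real K" "c i (zz g) * real K \<le> real K"
        by linarith+
      then show ?thesis
        by (simp add: le_floor_iff floor_le_iff)
    qed
    then show ?thesis by (auto simp: cell_def)
  qed
  then have sub: "cell ` ?G \<subseteq> ?C" by blast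
  have inj: "inj_on cell ?G"
  proof (rule inj_onI, rule ccontr)
    fix g h assume gh: "g \<in> ?G" "h \<in> ?G" "cell g = cell h" "g \<noteq> h"
    obtain j where j: "j \<in> T" "g j \<noteq> h j"
      using gh by (metis PiE_ext)
    have close: "\<bar>c i (zz g) - c i (zz h)\<bar> \<le> 1 / real K" if "i \<in> D" for i
    proof -
      have "\<lfloor>c i (zz g) * real K\<rfloor> = \<lfloor>c i (zz h) * real K\<rfloor>"
        using gh(3) that by (metis cell_def restrict_apply')
      then have "\<bar>c i (zz g) * real K - c i (zz h) * real K\<bar> \<le> 1"
        by linarith
      then have "\<bar>c i (zz g) - c i (zz h)\<bar> * real K \<le> 1"
        by (simp add: abs_mult flip: left_diff_distrib)
      then show ?thesis using K by (simp add: field_simps)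
    qed
    have "\<epsilon> / real Q \<le> \<bar>\<epsilon> * (real (g j) - real (h j)) / real Q\<bar>"
    proof -
      have "1 \<le> \<bar>real (g j) - real (h j)\<bar>" using j by linarith
      then have "\<epsilon> * 1 / real Q \<le> \<epsilon> * \<bar>real (g j) - real (h j)\<bar> / real Q"
        using \<epsilon> by (intro divide_right_mono mult_left_mono) auto
      then show ?thesis using \<epsilon> by (simp add: abs_mult)
    qed
    also have "\<dots> = \<bar>\<Psi> j (zz g) - \<Psi> j (zz h)\<bar>"
      using zz gh j by (simp add: pt_def algebra_simps diff_divide_distrib)
    also have "\<dots> \<le> L0 j * (\<Sum>i\<in>D. \<bar>c i (zz g) - c i (zz h)\<bar>)"
      using L0(2) j zz gh by blast
    also have "\<dots> \<le> L * (\<Sum>i\<in>D. 1 / real K)"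
      using L L0 j close by (intro mult_mono sum_mono sum_nonneg) auto
    also have "\<dots> = L * real d / real K"
      by (simp add: d_def)
    finally have "\<epsilon> / real Q \<le> L * real d / (real Q * real M)"
      by (simp add: K)
    then have "\<epsilon> * real M \<le> L * real d"
      using M Q by (simp add: field_simps)
    moreover have "L * real d < \<epsilon> * real M"
      using M(2) \<epsilon> by (simp add: field_simps)
    ultimately show False by simp
  qed
  have finC: "finite ?C" using fin by (intro finite_PiE) auto
  have "card ?G \<le> card ?C"
    using card_inj_on_le[OF inj sub finC] .
  then have "Q ^ card T \<le> (2 * K + 1) ^ d"
    using fin by (simp add: card_PiE d_def nat_add_distrib nat_mult_distrib) 
  also have "\<dots> \<le> (3 * K) ^ d"
    using K by (intro power_mono) auto
  also have "\<dots> = (3 * M) ^ d * Q ^ d"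
    by (simp add: K_def power_mult_distrib)
  also have "\<dots> < Q * Q ^ d"
    by (simp add: Q_def)
  also have "\<dots> \<le> Q ^ card T"
    using card unfolding d_def power_Suc[symmetric] by (intro power_increasing) (auto simp: Q_def)
  finally show False by simp
qed

lemma sum_Lipschitz_bounded:
  assumes "finite D" "sum_Lipschitz D c Z f" "\<And>i z. i \<in> D \<Longrightarrow> z \<in> Z \<Longrightarrow> \<bar>c i z\<bar> \<le> 1"
  obtains B where "B \<ge> 0" "\<And>z. z \<in> Z \<Longrightarrow> \<bar>f z\<bar> \<le> B"
proof (cases "Z = {}")
  case False
  then obtain y where y: "y \<in> Z" by blast
  obtain L where L: "L \<ge> 0" "\<And>u v. u \<in> Z \<Longrightarrow> v \<in> Z \<Longrightarrow> \<bar>f u - f v\<bar> \<le> L * (\<Sum>i\<in>D. \<bar>c i u - c i v\<bar>)"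
    using assms unfolding sum_Lipschitz_def by blast
  have "\<bar>f z\<bar> \<le> \<bar>f y\<bar> + L * (\<Sum>i\<in>D. 2)" if z: "z \<in> Z" for z
  proof -
    have "\<bar>c i z - c i y\<bar> \<le> 2" if "i \<in> D" for i
      using assms(3)[OF that z] assms(3)[OF that y] by linarith
    then have "L * (\<Sum>i\<in>D. \<bar>c i z - c i y\<bar>) \<le> L * (\<Sum>i\<in>D. 2)"
      using L by (intro mult_left_mono sum_mono) auto
    then show ?thesis using L(2)[OF z y] by linarith
  qed
  moreover have "\<bar>f y\<bar> + L * (\<Sum>i\<in>D. 2) \<ge> 0" using L by simp
  ultimately show thesis using that by blast
qed (use that[of 0] in auto)

lemma sum_Lipschitz_add:
  assumes "sum_Lipschitz D c Z f" "sum_Lipschitz D c Z g"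
  shows "sum_Lipschitz D c Z (\<lambda>z. f z + g z)"
proof -
  obtain L M where L: "L \<ge> 0" "\<And>u v. u \<in> Z \<Longrightarrow> v \<in> Z \<Longrightarrow> \<bar>f u - f v\<bar> \<le> L * (\<Sum>i\<in>D. \<bar>c i u - c i v\<bar>)"
    and M: "M \<ge> 0" "\<And>u v. u \<in> Z \<Longrightarrow> v \<in> Z \<Longrightarrow> \<bar>g u - g v\<bar> \<le> M * (\<Sum>i\<in>D. \<bar>c i u - c i v\<bar>)"
    using assms unfolding sum_Lipschitz_def by blast
  have "\<bar>f u + g u - (f v + g v)\<bar> \<le> (L + M) * (\<Sum>i\<in>D. \<bar>c i u - c i v\<bar>)" if "u \<in> Z" "v \<in> Z" for u v
    using L(2)[OF that] M(2)[OF that] by (simp add: distrib_right)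
  then show ?thesis
    unfolding sum_Lipschitz_def using L M by (intro exI[of _ "L + M"]) auto
qed

text \<open>The product rule for Lipschitz constants needs both functions bounded, which the bounded
  coordinates provide. Sums and products make these functions an algebra, as Stone-Weierstrass
  requires.\<close>

lemma sum_Lipschitz_mult:
  assumes fin: "finite D" and f: "sum_Lipschitz D c Z f" and g: "sum_Lipschitz D c Z g"
    and c: "\<And>i z. i \<in> D \<Longrightarrow> z \<in> Z \<Longrightarrow> \<bar>c i z\<bar> \<le> 1"
  shows "sum_Lipschitz D c Z (\<lambda>z. f z * g z)"
proof -
  obtain L M where L: "L \<ge> 0" "\<And>u v. u \<in> Z \<Longrightarrow> v \<in> Z \<Longrightarrow> \<bar>f u - f v\<bar> \<le> L * (\<Sum>i\<in>D. \<bar>c i u - c i v\<bar>)"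
    and M: "M \<ge> 0" "\<And>u v. u \<in> Z \<Longrightarrow> v \<in> Z \<Longrightarrow> \<bar>g u - g v\<bar> \<le> M * (\<Sum>i\<in>D. \<bar>c i u - c i v\<bar>)"
    using f g unfolding sum_Lipschitz_def by blast
  obtain A where A: "A \<ge> 0" "\<And>z. z \<in> Z \<Longrightarrow> \<bar>f z\<bar> \<le> A"
    using sum_Lipschitz_bounded[OF fin f c] by blast
  obtain B where B: "B \<ge> 0" "\<And>z. z \<in> Z \<Longrightarrow> \<bar>g z\<bar> \<le> B"
    using sum_Lipschitz_bounded[OF fin g c] by blast
  have "\<bar>f u * g u - f v * g v\<bar> \<le> (A * M + B * L) * (\<Sum>i\<in>D. \<bar>c i u - c i v\<bar>)" if "u \<in> Z" "v \<in> Z" for u v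
  proof -
    let ?S = "\<Sum>i\<in>D. \<bar>c i u - c i v\<bar>"
    have "\<bar>f u * g u - f v * g v\<bar> = \<bar>f u * (g u - g v) + g v * (f u - f v)\<bar>"
      by (simp add: algebra_simps)
    also have "\<dots> \<le> \<bar>f u\<bar> * \<bar>g u - g v\<bar> + \<bar>g v\<bar> * \<bar>f u - f v\<bar>"
      by (metis abs_triangle_ineq abs_mult)
    also have "\<dots> \<le> A * (M * ?S) + B * (L * ?S)"
      using A B L M that by (intro add_mono mult_mono) auto
    finally show ?thesis by (simp add: algebra_simps)
  qed
  then show ?thesis
    unfolding sum_Lipschitz_def using L M A B by (intro exI[of _ "A * M + B * L"]) auto
qed

text \<open>This plays the role of the vanishing of the homotopy groups of a sphere below its
  dimension. A Tietze extension may have zeros; near them it is replaced by a Lipschitz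
  approximation shifted by a small missed value.\<close>

proposition nonvanishing_extension:
  fixes c :: "'i \<Rightarrow> 'a::{metric_space,second_countable_topology} \<Rightarrow> real" and \<phi> :: "'t \<Rightarrow> 'a \<Rightarrow> real"
  assumes fin: "finite D" "finite T" and card: "card D < card T"
    and Z: "compact Z" and Y: "closed Y" "Y \<subseteq> Z"
    and c: "\<And>i z. i \<in> D \<Longrightarrow> z \<in> Z \<Longrightarrow> \<bar>c i z\<bar> \<le> 1" "\<And>i. i \<in> D \<Longrightarrow> continuous_on Z (c i)"
    and sep: "\<And>y z. y \<in> Z \<Longrightarrow> z \<in> Z \<Longrightarrow> y \<noteq> z \<Longrightarrow> \<exists>i\<in>D. c i y \<noteq> c i z"
    and \<phi>: "\<And>j. j \<in> T \<Longrightarrow> continuous_on Y (\<phi> j)" "\<And>y. y \<in> Y \<Longrightarrow> \<exists>j\<in>T. \<phi> j y \<noteq> 0"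
  obtains \<psi> where "\<And>j. j \<in> T \<Longrightarrow> continuous_on Z (\<psi> j)" "\<And>z. z \<in> Z \<Longrightarrow> \<exists>j\<in>T. \<psi> j z \<noteq> 0"
    "\<And>j y. j \<in> T \<Longrightarrow> y \<in> Y \<Longrightarrow> \<psi> j y = \<phi> j y"
proof -
  have clo: "closedin (top_of_set Z) Y"
    using Y by (simp add: closed_subset)
  have "\<exists>F. continuous_on Z F \<and> (\<forall>y\<in>Y. F y = \<phi> j y)" if "j \<in> T" for j
    using Tietze_unbounded[OF \<phi>(1)[OF that] clo] by metis
  then obtain \<Phi> where \<Phi>: "\<And>j. j \<in> T \<Longrightarrow> continuous_on Z (\<Phi> j)" "\<And>j y. j \<in> T \<Longrightarrow> y \<in> Y \<Longrightarrow> \<Phi> j y = \<phi> j y"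
    by metis
  define S where "S z = (\<Sum>j\<in>T. \<bar>\<Phi> j z\<bar>)" for z
  have Sc: "continuous_on Z S"
    unfolding S_def using \<Phi> by (intro continuous_intros) auto
  \<comment> \<open>On the compact set Y the size \<open>S\<close> is bounded away from 0, which
    leaves room for a transition between \<eta> and 2 \<eta>.\<close>
  have "\<exists>\<eta>>0. \<forall>y\<in>Y. 2 * \<eta> \<le> S y"
  proof (cases "Y = {}")
    case False
    have "compact Y"
      using Z Y by (metis compact_Int_closed inf.absorb_iff2)
    then obtain y0 where y0: "y0 \<in> Y" "\<And>y. y \<in> Y \<Longrightarrow> S y0 \<le> S y"
      using continuous_attains_inf[of Y S] False continuous_on_subset[OF Sc Y(2)] by blast
    obtain j where j: "j \<in> T" "\<phi> j y0 \<noteq> 0" using \<phi>(2)[OF y0(1)] by blast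
    have "0 < S y0"
      unfolding S_def using j \<Phi>(2)[OF j(1) y0(1)] fin by (intro sum_pos2[of _ j]) auto
    then show ?thesis using y0 by (intro exI[of _ "S y0 / 2"]) auto
  qed (auto intro: exI[of _ 1])
  then obtain \<eta> where \<eta>: "\<eta> > 0" "\<And>y. y \<in> Y \<Longrightarrow> 2 * \<eta> \<le> S y" by blast
  define N where "N = real (card T)"
  have N: "N > 0" using card fin by (simp add: N_def)
  \<comment> \<open>Approximation and shift together move each component by less than 2 \<epsilon>.
    A zero of the modified map therefore has S \<le> 2 \<epsilon> N = \<eta> / 2, well inside the
    region S \<le> \<eta>.\<close>
  define \<epsilon> where "\<epsilon> = \<eta> / (4 * N)"
  have \<epsilon>: "\<epsilon> > 0" using \<eta> N by (simp add: \<epsilon>_def)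
  have "\<exists>g. (continuous_on Z g \<and> sum_Lipschitz D c Z g) \<and> (\<forall>z\<in>Z. \<bar>\<Phi> j z - g z\<bar> < \<epsilon>)" if j: "j \<in> T" for j
  proof (rule Stone_Weierstrass_HOL[OF Z])
    show "continuous_on Z (\<lambda>x. a) \<and> sum_Lipschitz D c Z (\<lambda>x. a)" for a
      by (auto simp: sum_Lipschitz_def intro!: exI[of _ 0])
    show "\<exists>f. (continuous_on Z f \<and> sum_Lipschitz D c Z f) \<and> f x \<noteq> f y" if xy: "x \<in> Z \<and> y \<in> Z \<and> x \<noteq> y" for x y
    proof -
      obtain i where i: "i \<in> D" "c i x \<noteq> c i y" using sep xy by blast
      have "\<bar>c i y - c i z\<bar> \<le> 1 * (\<Sum>i\<in>D. \<bar>c i y - c i z\<bar>)" for y z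
        using member_le_sum[OF i(1) _ fin(1), of "\<lambda>i. \<bar>c i y - c i z\<bar>"] by simp
      then have "sum_Lipschitz D c Z (c i)"
        unfolding sum_Lipschitz_def using zero_le_one by blast
      then show ?thesis using i c(2) by blast
    qed
    fix f g assume "(continuous_on Z f \<and> sum_Lipschitz D c Z f) \<and> (continuous_on Z g \<and> sum_Lipschitz D c Z g)"
    then have fg: "continuous_on Z f" "continuous_on Z g" "sum_Lipschitz D c Z f" "sum_Lipschitz D c Z g"
      by blast+
    show "continuous_on Z (\<lambda>x. f x + g x) \<and> sum_Lipschitz D c Z (\<lambda>x. f x + g x)"
      by (rule conjI[OF continuous_on_add[OF fg(1,2)] sum_Lipschitz_add[OF fg(3,4)]])
    show "continuous_on Z (\<lambda>x. f x * g x) \<and> sum_Lipschitz D c Z (\<lambda>x. f x * g x)"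
      by (rule conjI[OF continuous_on_mult[OF fg(1,2)] sum_Lipschitz_mult[OF fin(1) fg(3,4) c(1)]])
  qed (use \<Phi>(1)[OF j] \<epsilon> in auto)
  then obtain \<Psi> where \<Psi>: "\<And>j. j \<in> T \<Longrightarrow> continuous_on Z (\<Psi> j)" "\<And>j. j \<in> T \<Longrightarrow> sum_Lipschitz D c Z (\<Psi> j)"
    "\<And>j z. j \<in> T \<Longrightarrow> z \<in> Z \<Longrightarrow> \<bar>\<Phi> j z - \<Psi> j z\<bar> < \<epsilon>"
    by metis
  obtain a where a: "\<And>j. j \<in> T \<Longrightarrow> \<bar>a j\<bar> < \<epsilon>" "\<And>z. z \<in> Z \<Longrightarrow> \<exists>j\<in>T. \<Psi> j z \<noteq> a j"
    using sum_Lipschitz_missed_value[where \<Psi> = \<Psi>, OF fin card \<epsilon> c(1) \<Psi>(2)] by blast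
  \<comment> \<open>The cut-off is 0 for S \<ge> 2 \<eta>, in particular on Y, and 1 for S \<le>
    \<eta>. A zero of \<open>\<psi>\<close> would lie where it is 1, and there \<open>\<psi>\<close>
    is the shifted approximation, which misses 0.\<close>
  define \<mu> where "\<mu> z = max 0 (min 1 ((2 * \<eta> - S z) / \<eta>))" for z
  define \<psi> where "\<psi> j z = \<Phi> j z + \<mu> z * (\<Psi> j z - a j - \<Phi> j z)" for j z
  have \<mu>01: "0 \<le> \<mu> z" "\<mu> z \<le> 1" for z by (auto simp: \<mu>_def)
  show thesis
  proof (rule that)
    have "continuous_on Z \<mu>"
      unfolding \<mu>_def using \<eta> by (intro continuous_intros Sc) auto
    then show "continuous_on Z (\<psi> j)" if "j \<in> T" for j
      unfolding \<psi>_def using \<Phi>(1) \<Psi>(1) that by (intro continuous_intros) auto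
    show "\<psi> j y = \<phi> j y" if "j \<in> T" "y \<in> Y" for j y
    proof -
      have "(2 * \<eta> - S y) / \<eta> \<le> 0" using \<eta> that by (simp add: divide_le_0_iff)
      then have "\<mu> y = 0" by (simp add: \<mu>_def)
      then show ?thesis using \<Phi>(2) that by (simp add: \<psi>_def)
    qed
    show "\<exists>j\<in>T. \<psi> j z \<noteq> 0" if z: "z \<in> Z" for z
    proof (rule ccontr)
      assume "\<not> ?thesis"
      then have 0: "\<psi> j z = 0" if "j \<in> T" for j using that by blast
      have "\<bar>\<Phi> j z\<bar> \<le> 2 * \<epsilon>" if j: "j \<in> T" for j
      proof -
        have "\<bar>\<Phi> j z\<bar> = \<mu> z * \<bar>\<Psi> j z - a j - \<Phi> j z\<bar>"
          using 0[OF j] \<mu>01[of z] unfolding \<psi>_def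
          by (metis abs_minus_cancel abs_mult abs_of_nonneg add_eq_0_iff minus_add_cancel)
        also have "\<dots> \<le> 1 * (2 * \<epsilon>)"
          using \<mu>01[of z] \<Psi>(3)[OF j z] a(1)[OF j] by (intro mult_mono) auto
        finally show ?thesis by simp
      qed
      then have "S z \<le> (\<Sum>j\<in>T. 2 * \<epsilon>)"
        unfolding S_def by (rule sum_mono)
      also have "\<dots> = \<eta> / 2"
        using N by (simp add: \<epsilon>_def N_def)
      finally have "S z \<le> \<eta>" using \<eta> by simp
      then have "1 \<le> (2 * \<eta> - S z) / \<eta>"
        using \<eta> by (simp add: field_simps)
      then have "\<mu> z = 1" by (simp add: \<mu>_def)
      then have "\<Psi> j z = a j" if "j \<in> T" for j
        using 0[OF that] by (simp add: \<psi>_def)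
      then show False using a(2)[OF z] by blast
    qed
  qed
qed

subsection \<open>Extension over the cells of the polydisc\<close>

text \<open>
  The coordinates below \<open>m\<close> parametrize a polydisc, and coordinate \<open>m\<close> is the time parameter of a
  homotopy. Coordinates below \<open>m\<close> outside \<open>F\<close> are frozen at \<open>1\<close>, the base point of the circle.
\<close>

definition cell_factor :: "nat \<Rightarrow> nat set \<Rightarrow> nat \<Rightarrow> complex set" where
  "cell_factor m F k =
     (if k < m then if k \<in> F then cball 0 1 else {1} else if k = m then of_real ` {0..1} else {0})"

definition cell :: "nat \<Rightarrow> nat set \<Rightarrow> (nat \<Rightarrow> complex) set" where
  "cell m F = {w. \<forall>k. w k \<in> cell_factor m F k}"

text \<open>In the inductions below, \<open>J\<close> collects the coordinates whose boundary faces
  have been dealt with.\<close>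

definition cell_bd :: "nat \<Rightarrow> nat set \<Rightarrow> nat set \<Rightarrow> (nat \<Rightarrow> complex) set" where
  "cell_bd m J F = {w \<in> cell m F. \<exists>k\<in>J. cmod (w k) = 1}"

definition cell_ends :: "nat \<Rightarrow> nat set \<Rightarrow> (nat \<Rightarrow> complex) set" where
  "cell_ends m F = {w \<in> cell m F. w m = 0 \<or> w m = 1}"

text \<open>
  The condition on the coordinates in \<open>K\<close> says that \<open>\<phi>\<close> descends to a section of a line bundle of degree
  \<open>b k\<close> over the sphere obtained by collapsing the boundary of the \<open>k\<close>-th disc.
\<close>

definition section_on :: "nat \<Rightarrow> (nat \<Rightarrow> nat) \<Rightarrow> nat set \<Rightarrow> (nat \<Rightarrow> complex) set \<Rightarrow> ((nat \<Rightarrow> complex) \<Rightarrow> nat \<Rightarrow> complex) \<Rightarrow> bool" where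
  "section_on m b K X \<phi> \<longleftrightarrow>
     (\<forall>j<m. continuous_on X (\<lambda>w. \<phi> w j)) \<and> (\<forall>w\<in>X. \<exists>j<m. \<phi> w j \<noteq> 0) \<and>
     (\<forall>k\<in>K. \<forall>w\<in>X. cmod (w k) = 1 \<longrightarrow> (\<forall>j<m. \<phi> w j = w k ^ b k * \<phi> (w(k := 1)) j))"

lemma section_on_subset: "section_on m b K X \<phi> \<Longrightarrow> Y \<subseteq> X \<Longrightarrow> L \<subseteq> K \<Longrightarrow> section_on m b L Y \<phi>"
  unfolding section_on_def by (meson continuous_on_subset subsetD)

lemma section_on_continuous: "section_on m b K X \<phi> \<Longrightarrow> j < m \<Longrightarrow> continuous_on X (\<lambda>w. \<phi> w j)"
  unfolding section_on_def by blast

lemma section_on_nonzero: "section_on m b K X \<phi> \<Longrightarrow> w \<in> X \<Longrightarrow> \<exists>j<m. \<phi> w j \<noteq> 0"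
  unfolding section_on_def by blast

lemma section_on_upd:
  "section_on m b K X \<phi> \<Longrightarrow> k \<in> K \<Longrightarrow> w \<in> X \<Longrightarrow> cmod (w k) = 1 \<Longrightarrow> j < m \<Longrightarrow>
    \<phi> w j = w k ^ b k * \<phi> (w(k := 1)) j"
  unfolding section_on_def by blast

lemma compact_cell: "compact (cell m F)"
proof -
  have "compact (cell_factor m F k)" for k
    unfolding cell_factor_def by (auto intro!: compact_continuous_image continuous_intros)
  then have "compactin (product_topology (\<lambda>_. euclidean) UNIV) (PiE UNIV (cell_factor m F))"
    by (simp add: compactin_PiE)
  moreover have "PiE UNIV (cell_factor m F) = cell m F"
    by (auto simp: cell_def PiE_iff)
  ultimately show ?thesis
    by (simp add: euclidean_product_topology)
qed

lemma closed_cell: "closed (cell m F)"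
  by (rule compact_imp_closed[OF compact_cell])

lemma closed_cmod_eq_1: "closed {w :: nat \<Rightarrow> complex. cmod (w k) = 1}"
  by (intro closed_Collect_eq continuous_intros) auto

lemma closed_cell_bd: "finite J \<Longrightarrow> closed (cell_bd m J F)"
proof -
  assume J: "finite J"
  have "cell_bd m J F = cell m F \<inter> (\<Union>k\<in>J. {w. cmod (w k) = 1})"
    by (auto simp: cell_bd_def)
  then show ?thesis
    using J by (auto intro!: closed_Int closed_cell closed_UN closed_cmod_eq_1)
qed

lemma closed_coord_eq: "closed {w :: nat \<Rightarrow> complex. w k = c}"
  by (intro closed_Collect_eq continuous_intros) auto

lemma closed_cell_ends: "closed (cell_ends m F)"
proof -
  have "cell_ends m F = cell m F \<inter> ({w. w m = 0} \<union> {w. w m = 1})"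
    by (auto simp: cell_ends_def)
  then show ?thesis
    by (auto intro!: closed_Int closed_Un closed_cell closed_coord_eq)
qed

lemma cell_remove: "k < m \<Longrightarrow> k \<in> F \<Longrightarrow> cell m (F - {k}) = {w \<in> cell m F. w k = 1}"
  by (fastforce simp: cell_def cell_factor_def split: if_splits)

lemma cell_upd: "w \<in> cell m F \<Longrightarrow> k < m \<Longrightarrow> w(k := 1) \<in> cell m F"
proof -
  assume w: "w \<in> cell m F" "k < m"
  then have "1 \<in> cell_factor m F k" by (simp add: cell_factor_def)
  then show ?thesis using w by (simp add: cell_def)
qed

text \<open>The condition at k dictates the values on the face |w k| = 1 once they are known on the
  slice w k = 1. The set \<open>T\<close> is kept general because it is the two ends of a full cell
  in one use and the two ends of the boundary cylinder in another.\<close>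

lemma paste_face:
  assumes F: "F \<subseteq> {..<m}" "k \<in> F" "J \<subseteq> F" "K \<subseteq> F" "K \<inter> J = {}" "k \<notin> J"
    and T: "closed T" "T \<subseteq> cell m F" "\<And>w l. w \<in> T \<Longrightarrow> l \<in> F \<Longrightarrow> cmod (w l) = 1 \<Longrightarrow> w(l := 1) \<in> T"
    and \<phi>: "section_on m b (insert k K) (T \<union> cell_bd m J F) \<phi>"
    and \<psi>: "section_on m b K (cell m (F - {k})) \<psi>"
    and eq: "\<And>w j. w \<in> cell m (F - {k}) \<Longrightarrow> w \<in> T \<union> cell_bd m J F \<Longrightarrow> j < m \<Longrightarrow> \<psi> w j = \<phi> w j"
  obtains \<phi>' where "section_on m b (insert k K) (T \<union> cell_bd m (insert k J) F) \<phi>'"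
    "\<And>w j. w \<in> T \<union> cell_bd m J F \<Longrightarrow> j < m \<Longrightarrow> \<phi>' w j = \<phi> w j"
proof -
  define A where "A = T \<union> cell_bd m J F"
  define B where "B = {w \<in> cell m F. cmod (w k) = 1}"
  have km: "k < m" using F by auto
  have AB: "T \<union> cell_bd m (insert k J) F = A \<union> B"
    by (auto simp: A_def B_def cell_bd_def)
  have "finite J" using F by (meson finite_lessThan finite_subset)
  then have clA: "closed A" unfolding A_def using T by (intro closed_Un closed_cell_bd)
  have "B = cell m F \<inter> {w. cmod (w k) = 1}" by (auto simp: B_def)
  then have clB: "closed B" by (simp add: closed_Int closed_cell closed_cmod_eq_1)
  have A_cell: "A \<subseteq> cell m F" using T by (auto simp: A_def cell_bd_def)
  have A_upd: "w(l := 1) \<in> A" if "w \<in> A" "l \<in> insert k K" "cmod (w l) = 1" for w l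
  proof (cases "w \<in> T")
    case True
    then show ?thesis using T(3)[OF True _ that(3)] that(2) F by (auto simp: A_def)
  next
    case False
    then have w: "w \<in> cell m F" "\<exists>i\<in>J. cmod (w i) = 1" using that by (auto simp: A_def cell_bd_def)
    have "l < m" "l \<notin> J" using that F by auto
    then have "w(l := 1) \<in> cell_bd m J F"
      using w cell_upd[OF w(1)] by (auto simp: cell_bd_def)
    then show ?thesis by (simp add: A_def)
  qed
  have B_upd: "w(l := 1) \<in> B" if "w \<in> B" "l \<in> insert k K" for w l
    using that F cell_upd[of w m F l] by (auto simp: B_def)
  have B_face: "w(k := 1) \<in> cell m (F - {k})" if "w \<in> cell m F" for w
    using cell_upd[OF that km] F km by (simp add: cell_remove)
  \<comment> \<open>On the overlap of \<open>A\<close> and \<open>B\<close> both formulas agree,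
    since \<open>\<phi>\<close> satisfies the condition at k and equals \<open>\<psi>\<close> on the
    slice. As both sets are closed, this gives continuity.\<close>
  define \<phi>' where "\<phi>' w j = (if w \<in> A then \<phi> w j else w k ^ b k * \<psi> (w(k := 1)) j)" for w j
  have hA: "\<phi>' w j = \<phi> w j" if "w \<in> A" for w j
    using that by (simp add: \<phi>'_def)
  have hB: "\<phi>' w j = w k ^ b k * \<psi> (w(k := 1)) j" if w: "w \<in> B" "j < m" for w j
  proof (cases "w \<in> A")
    case True
    have k1: "cmod (w k) = 1" using w by (simp add: B_def)
    have "w(k := 1) \<in> A" using A_upd[OF True _ k1] by simp
    moreover have "w(k := 1) \<in> cell m (F - {k})" using B_face w by (simp add: B_def)
    ultimately have "\<psi> (w(k := 1)) j = \<phi> (w(k := 1)) j"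
      using eq w by (simp add: A_def)
    moreover have "\<phi> w j = w k ^ b k * \<phi> (w(k := 1)) j"
      using section_on_upd[OF \<phi> insertI1 True[unfolded A_def] k1 w(2)] .
    ultimately show ?thesis using True by (simp add: \<phi>'_def)
  qed (simp add: \<phi>'_def)
  have upd_cont: "continuous_on X (\<lambda>w::nat\<Rightarrow>complex. w(k := 1))" for X
  proof (rule continuous_on_coordinatewise_then_product)
    show "continuous_on X (\<lambda>w::nat\<Rightarrow>complex. (w(k := 1)) i)" for i
      by (cases "i = k") (auto intro: continuous_on_subset[OF continuous_on_product_coordinates])
  qed
  have "section_on m b (insert k K) (A \<union> B) \<phi>'"
    unfolding section_on_def
  proof (intro conjI allI ballI impI)
    fix j assume j: "j < m"
    have "continuous_on A (\<lambda>w. \<phi> w j)"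
      using \<phi> j by (simp add: section_on_def A_def)
    then have "continuous_on A (\<lambda>w. \<phi>' w j)"
      by (rule continuous_on_eq) (simp add: hA)
    moreover
    have "continuous_on B (\<lambda>w. w k ^ b k * \<psi> (w(k := 1)) j)"
    proof (intro continuous_intros)
      show "continuous_on B (\<lambda>w. w k)"
        by (rule continuous_on_subset[OF continuous_on_product_coordinates]) simp
      have "continuous_on (cell m (F - {k})) (\<lambda>w. \<psi> w j)"
        using \<psi> j by (simp add: section_on_def)
      then show "continuous_on B (\<lambda>w. \<psi> (w(k := 1)) j)"
        by (rule continuous_on_compose2[OF _ upd_cont]) (use B_face in \<open>auto simp: B_def\<close>)
    qed
    then have "continuous_on B (\<lambda>w. \<phi>' w j)"
      by (rule continuous_on_eq) (simp add: hB j)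
    ultimately show "continuous_on (A \<union> B) (\<lambda>w. \<phi>' w j)"
      by (rule continuous_on_closed_Un[OF clA clB])
  next
    fix w assume w: "w \<in> A \<union> B"
    show "\<exists>j<m. \<phi>' w j \<noteq> 0"
    proof (cases "w \<in> A")
      case True
      then show ?thesis using section_on_nonzero[OF \<phi>, of w] hA[OF True] by (simp add: A_def)
    next
      case False
      then have wB: "w \<in> B" using w by simp
      then have "w(k := 1) \<in> cell m (F - {k})" using B_face by (simp add: B_def)
      then obtain j where "j < m" "\<psi> (w(k := 1)) j \<noteq> 0"
        using section_on_nonzero[OF \<psi>] by blast
      moreover have "w k \<noteq> 0" using wB by (auto simp: B_def)
      ultimately show ?thesis using hB[OF wB] by auto
    qed
  next
    fix l w j assume l: "l \<in> insert k K" and w: "w \<in> A \<union> B" "cmod (w l) = 1" and j: "j < m"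
    show "\<phi>' w j = w l ^ b l * \<phi>' (w(l := 1)) j"
    proof (cases "w \<in> A")
      case True
      show ?thesis
        unfolding hA[OF True] hA[OF A_upd[OF True l w(2)]]
        by (rule section_on_upd[where k = l, OF \<phi> l True[unfolded A_def] w(2) j])
    next
      case False
      then have wB: "w \<in> B" using w by simp
      note hB[OF wB j] hB[OF B_upd[OF wB l] j]
      moreover have "\<psi> (w(k := 1)) j = (w(k := 1)) l ^ b l * \<psi> (w(k := 1, l := 1)) j" if "l \<noteq> k"
        using section_on_upd[OF \<psi>, of l "w(k := 1)" j] l that w j B_face wB by (auto simp: B_def)
      ultimately show ?thesis
        by (cases "l = k") (auto simp: fun_upd_twist)
    qed
  qed
  then show thesis
    using that[of \<phi>'] hA unfolding AB by (auto simp: A_def)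
qed

lemma cell_eqI:
  assumes "y \<in> cell m F" "z \<in> cell m F" "F \<subseteq> {..<m}" "\<And>k. k \<in> F \<Longrightarrow> y k = z k" "Re (y m) = Re (z m)"
  shows "y = z"
proof
  fix k
  have "y k \<in> cell_factor m F k" "z k \<in> cell_factor m F k" using assms by (auto simp: cell_def)
  then show "y k = z k"
    using assms(4)[of k] assms(5) by (auto simp: cell_factor_def split: if_splits)
qed

text \<open>The cell has 2 card F real coordinates and the time, at most 2 m - 1 in all, against 2 m
  real components of a value.\<close>

lemma cell_filling:
  assumes F: "F \<subseteq> {..<m}" "card F < m" and \<phi>: "section_on m b {} (cell_ends m F \<union> cell_bd m F F) \<phi>"
  shows "\<exists>\<psi>. section_on m b {} (cell m F) \<psi> \<and>
    (\<forall>w\<in>cell_ends m F \<union> cell_bd m F F. \<forall>j<m. \<psi> w j = \<phi> w j)"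
proof -
  define part where "part z s = (if s then Im z else Re z)" for z :: complex and s
  \<comment> \<open>The flag selects the imaginary part; time is real and contributes only its real
    part.\<close>
  let ?D = "F \<times> (UNIV::bool set) \<union> {(m, False)}" and ?T = "{..<m} \<times> (UNIV::bool set)"
  let ?c = "\<lambda>i (w::nat \<Rightarrow> complex). part (w (fst i)) (snd i)"
  let ?Y = "cell_ends m F \<union> cell_bd m F F"
  have finF: "finite F" using F by (meson finite_lessThan finite_subset)
  have part_le: "\<bar>part z s\<bar> \<le> cmod z" for z s
    by (simp add: part_def abs_Re_le_cmod abs_Im_le_cmod)
  have part_cont: "continuous_on X (\<lambda>w. part (g w) s)" if "continuous_on X g" for X s and g :: "(nat \<Rightarrow> complex) \<Rightarrow> complex"
    unfolding part_def using that by (cases s) (auto intro!: continuous_intros)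
  have part_eqI: "y = z" if "\<And>s. part y s = part z s" for y z
    using that[of True] that[of False] by (simp add: part_def complex_eq_iff)
  have "\<exists>\<psi>. (\<forall>j\<in>?T. continuous_on (cell m F) (\<psi> j)) \<and> (\<forall>z\<in>cell m F. \<exists>j\<in>?T. \<psi> j z \<noteq> 0) \<and>
      (\<forall>j\<in>?T. \<forall>y\<in>?Y. \<psi> j y = part (\<phi> y (fst j)) (snd j))"
  proof (rule nonvanishing_extension[of ?D ?T "cell m F" ?Y ?c "\<lambda>j w. part (\<phi> w (fst j)) (snd j)"])
    have "card ?D \<le> card (F \<times> (UNIV::bool set)) + 1"
      using card_Un_le[of "F \<times> (UNIV::bool set)" "{(m, False)}"] by simp
    also have "\<dots> < card ?T" using F by (simp add: card_cartesian_product)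
    finally show "card ?D < card ?T" .
    show "closed ?Y"
      by (rule closed_Un[OF closed_cell_ends closed_cell_bd[OF finF]])
    show "?Y \<subseteq> cell m F"
      by (auto simp: cell_ends_def cell_bd_def)
    show "\<bar>?c i z\<bar> \<le> 1" if "i \<in> ?D" "z \<in> cell m F" for i z
    proof -
      have "z (fst i) \<in> cell_factor m F (fst i)" using that(2) by (simp add: cell_def)
      then have "cmod (z (fst i)) \<le> 1" by (auto simp: cell_factor_def split: if_splits)
      then show ?thesis using part_le order_trans by blast
    qed
    show "continuous_on (cell m F) (?c i)" for i
      by (intro part_cont continuous_on_subset[OF continuous_on_product_coordinates]) simp
    show "\<exists>i\<in>?D. ?c i y \<noteq> ?c i z" if "y \<in> cell m F" "z \<in> cell m F" "y \<noteq> z" for y z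
    proof (rule ccontr)
      assume "\<not> ?thesis"
      then have *: "?c i y = ?c i z" if "i \<in> ?D" for i using that by blast
      have "y k = z k" if "k \<in> F" for k
        using *[of "(k, _)"] that by (intro part_eqI) auto
      moreover have "Re (y m) = Re (z m)"
        using *[of "(m, False)"] by (simp add: part_def)
      ultimately show False using cell_eqI[OF that(1,2) F(1)] that(3) by blast
    qed
    show "continuous_on ?Y (\<lambda>w. part (\<phi> w (fst j)) (snd j))" if "j \<in> ?T" for j
      using that by (intro part_cont section_on_continuous[OF \<phi>]) auto
    show "\<exists>j\<in>?T. part (\<phi> y (fst j)) (snd j) \<noteq> 0" if "y \<in> ?Y" for y
    proof -
      obtain j where j: "j < m" "\<phi> y j \<noteq> 0" using section_on_nonzero[OF \<phi>] \<open>y \<in> ?Y\<close> by blast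
      then obtain s where "part (\<phi> y j) s \<noteq> part 0 s" using part_eqI by metis
      then show ?thesis using j by (intro bexI[of _ "(j, s)"]) (auto simp: part_def)
    qed
    show "finite ?D" "finite ?T" "compact (cell m F)"
      using finF compact_cell by auto
    fix \<psi> assume "\<And>j. j \<in> ?T \<Longrightarrow> continuous_on (cell m F) (\<psi> j)" "\<And>z. z \<in> cell m F \<Longrightarrow> \<exists>j\<in>?T. \<psi> j z \<noteq> 0"
      "\<And>j y. j \<in> ?T \<Longrightarrow> y \<in> ?Y \<Longrightarrow> \<psi> j y = part (\<phi> y (fst j)) (snd j)"
    then show "\<exists>\<psi>. (\<forall>j\<in>?T. continuous_on (cell m F) (\<psi> j)) \<and> (\<forall>z\<in>cell m F. \<exists>j\<in>?T. \<psi> j z \<noteq> 0) \<and>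
      (\<forall>j\<in>?T. \<forall>y\<in>?Y. \<psi> j y = part (\<phi> y (fst j)) (snd j))"
      by (intro exI[of _ \<psi>] conjI ballI)
  qed
  then obtain \<psi> where *: "(\<forall>j\<in>?T. continuous_on (cell m F) (\<psi> j)) \<and> (\<forall>z\<in>cell m F. \<exists>j\<in>?T. \<psi> j z \<noteq> 0) \<and>
      (\<forall>j\<in>?T. \<forall>y\<in>?Y. \<psi> j y = part (\<phi> y (fst j)) (snd j))"
    by (rule exE)
  have \<psi>: "continuous_on (cell m F) (\<psi> (j, s))" "y \<in> ?Y \<Longrightarrow> \<psi> (j, s) y = part (\<phi> y j) s" if "j < m" for j s y
    using * that by simp_all
  have \<psi>_nz: "\<exists>j s. j < m \<and> \<psi> (j, s) z \<noteq> 0" if "z \<in> cell m F" for z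
    using conjunct1[OF conjunct2[OF *]] that by fastforce
  define \<theta> where "\<theta> w j = Complex (\<psi> (j, False) w) (\<psi> (j, True) w)" for w j
  show ?thesis
  proof (intro exI[of _ \<theta>] conjI ballI allI impI)
    show "section_on m b {} (cell m F) \<theta>"
      unfolding section_on_def
    proof (intro conjI ballI allI impI)
      show "continuous_on (cell m F) (\<lambda>w. \<theta> w j)" if "j < m" for j
        unfolding \<theta>_def Complex_eq using \<psi>(1)[OF that] by (intro continuous_intros)
      fix w assume "w \<in> cell m F"
      then obtain j s where "j < m" "\<psi> (j, s) w \<noteq> 0" using \<psi>_nz by blast
      then show "\<exists>j<m. \<theta> w j \<noteq> 0"
        by (intro exI[of _ j]) (cases s; auto simp: \<theta>_def complex_eq_iff)
    qed auto
    show "\<theta> w j = \<phi> w j" if "w \<in> ?Y" "j < m" for w j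
      using \<psi>(2)[OF that(2,1)] by (simp add: \<theta>_def part_def complex_eq_iff)
  qed
qed

text \<open>\<open>J\<close> is arbitrary because the induction moves a coordinate from
  \<open>K\<close> to \<open>J\<close>. The hypothesis is used twice: on the slice w k = 1, a cell
  with one disc fewer, and on the whole cell after the slice has been spread over |w k| = 1.\<close>

lemma cell_extension:
  assumes "finite K"
  shows "\<And>J \<phi>. K \<inter> J = {} \<Longrightarrow> K \<union> J \<subseteq> {..<m} \<Longrightarrow> card (K \<union> J) < m \<Longrightarrow>
      section_on m b K (cell_ends m (K \<union> J) \<union> cell_bd m J (K \<union> J)) \<phi> \<Longrightarrow>
    \<exists>\<psi>. section_on m b K (cell m (K \<union> J)) \<psi> \<and>
      (\<forall>w\<in>cell_ends m (K \<union> J) \<union> cell_bd m J (K \<union> J). \<forall>j<m. \<psi> w j = \<phi> w j)"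
  using assms
proof (induction K)
  case empty
  then show ?case using cell_filling[of J m b \<phi>] by simp
next
  case (insert k K)
  let ?F = "insert k (K \<union> J)"
  let ?X = "cell_ends m ?F \<union> cell_bd m J ?F"
  have k: "k \<in> ?F" "k < m" "k \<notin> J" and Fk: "?F - {k} = K \<union> J"
    using insert by auto
  have fin: "finite (K \<union> J)" using insert.prems(2) by (meson Un_subset_iff finite_lessThan finite_subset insert_subset Un_insert_left)
  have card: "card (K \<union> J) < m" "card (K \<union> insert k J) < m"
    using insert.prems(3) fin by (auto simp: card_insert_if split: if_splits)
  have face: "cell m (K \<union> J) = {w \<in> cell m ?F. w k = 1}"
    using cell_remove[OF k(2,1)] unfolding Fk by simp
  have face_X: "w \<in> cell_ends m (K \<union> J) \<union> cell_bd m J (K \<union> J)" if "w \<in> cell m (K \<union> J)" "w \<in> ?X" for w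
    using that by (auto simp: cell_ends_def cell_bd_def)
  have X_face: "cell_ends m (K \<union> J) \<union> cell_bd m J (K \<union> J) \<subseteq> ?X"
    unfolding cell_ends_def cell_bd_def face by auto
  have \<phi>: "section_on m b (insert k K) ?X \<phi>"
    using insert.prems(4) by simp
  obtain \<psi> where \<psi>: "section_on m b K (cell m (K \<union> J)) \<psi>"
      "\<And>w j. w \<in> cell_ends m (K \<union> J) \<union> cell_bd m J (K \<union> J) \<Longrightarrow> j < m \<Longrightarrow> \<psi> w j = \<phi> w j"
    using insert.IH[of J \<phi>] section_on_subset[OF \<phi> X_face subset_insertI] insert.prems card by auto
  obtain \<phi>' where \<phi>': "section_on m b (insert k K) (cell_ends m ?F \<union> cell_bd m (insert k J) ?F) \<phi>'"
    "\<And>w j. w \<in> ?X \<Longrightarrow> j < m \<Longrightarrow> \<phi>' w j = \<phi> w j"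
  proof (rule paste_face[of ?F m k J K "cell_ends m ?F" b \<phi> \<psi>])
    show "w(l := 1) \<in> cell_ends m ?F" if "w \<in> cell_ends m ?F" "l \<in> ?F" for w l
    proof -
      have "l < m" using that(2) insert.prems(2) by auto
      then show ?thesis using that(1) cell_upd[of w m ?F l] by (auto simp: cell_ends_def)
    qed
    show "\<psi> w j = \<phi> w j" if "w \<in> cell m (?F - {k})" "w \<in> ?X" "j < m" for w j
      using \<psi>(2)[OF face_X] that unfolding Fk by blast
  qed (use insert.prems insert.hyps k \<phi> \<psi>(1) Fk closed_cell_ends in \<open>auto simp: cell_ends_def\<close>)
  have "K \<union> insert k J = ?F" by auto
  then obtain \<theta> where \<theta>: "section_on m b K (cell m ?F) \<theta>"
      "\<And>w j. w \<in> cell_ends m ?F \<union> cell_bd m (insert k J) ?F \<Longrightarrow> j < m \<Longrightarrow> \<theta> w j = \<phi>' w j"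
    using insert.IH[of "insert k J" \<phi>'] section_on_subset[OF \<phi>'(1) order_refl subset_insertI] insert.prems insert.hyps card by auto
  have "section_on m b (insert k K) (cell m ?F) \<theta>"
    unfolding section_on_def
  proof (intro conjI ballI allI impI)
    fix l w j assume l: "l \<in> insert k K" and w: "w \<in> cell m ?F" "cmod (w l) = 1" and j: "j < m"
    show "\<theta> w j = w l ^ b l * \<theta> (w(l := 1)) j"
    proof (cases "l = k")
      case True
      \<comment> \<open>Every point with |w k| = 1 lies where \<open>\<theta>\<close> agrees with
        \<open>\<phi>'\<close>, so the condition at k is inherited.\<close>
      have "w \<in> cell_bd m (insert k J) ?F" "w(k := 1) \<in> cell_bd m (insert k J) ?F"
        using w cell_upd[OF w(1) k(2)] True by (auto simp: cell_bd_def)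
      then show ?thesis
        using \<theta>(2)[of w j] \<theta>(2)[of "w(k := 1)" j] section_on_upd[OF \<phi>'(1), of k w j] w j True by simp
    next
      case False
      then show ?thesis using section_on_upd[OF \<theta>(1) _ w j] l by blast
    qed
  qed (use section_on_continuous[OF \<theta>(1)] section_on_nonzero[OF \<theta>(1)] in blast)+
  moreover have "\<theta> w j = \<phi> w j" if "w \<in> ?X" "j < m" for w j
    using \<theta>(2)[of w j] \<phi>'(2)[of w j] that by (auto simp: cell_bd_def)
  ultimately show ?case by auto
qed

text \<open>The faces |w k| = 1 of the cylinder are filled one after another from their slices; when
  \<open>K\<close> is exhausted, they cover the cylinder over the whole boundary. \<open>T\<close>
  consists of its two ends.\<close>

lemma boundary_extension:
  fixes m :: nat
  assumes "finite K"
  defines "C \<equiv> {..<m}" and "T \<equiv> {w \<in> cell_ends m {..<m}. \<exists>k<m. cmod (w k) = 1}"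
  shows "\<And>J \<phi>. K \<inter> J = {} \<Longrightarrow> K \<union> J = C \<Longrightarrow> section_on m b K (T \<union> cell_bd m J C) \<phi> \<Longrightarrow>
    \<exists>\<psi>. section_on m b {} (cell_bd m C C) \<psi> \<and> (\<forall>w\<in>T. \<forall>j<m. \<psi> w j = \<phi> w j)"
  using assms(1)
proof (induction K)
  case empty
  then have "T \<union> cell_bd m J C = cell_bd m C C"
    by (auto simp: T_def C_def cell_bd_def cell_ends_def)
  then show ?case using empty by (intro exI[of _ \<phi>]) auto
next
  case (insert k K)
  have k: "k < m" "k \<in> C" "k \<notin> J" and Fk: "C - {k} = K \<union> J"
    using insert by (auto simp: C_def)
  have face: "cell m (K \<union> J) = {w \<in> cell m C. w k = 1}"
    using cell_remove[OF k(1,2)] unfolding Fk by simp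
  have face_X: "cell m (K \<union> J) \<inter> (T \<union> cell_bd m J C) = cell_ends m (K \<union> J) \<union> cell_bd m J (K \<union> J)"
    using k(1) unfolding face T_def cell_ends_def cell_bd_def C_def by (auto simp: face[unfolded C_def])
  \<comment> \<open>The slice has only m - 1 discs, which is the dimension bound of
    \<open>cell_extension\<close>.\<close>
  have "card (K \<union> J) < m"
    using k(2) unfolding Fk[symmetric] C_def by (simp add: card_Diff_singleton_if)
  then obtain \<psi> where \<psi>: "section_on m b K (cell m (K \<union> J)) \<psi>"
      "\<And>w j. w \<in> cell_ends m (K \<union> J) \<union> cell_bd m J (K \<union> J) \<Longrightarrow> j < m \<Longrightarrow> \<psi> w j = \<phi> w j"
    using cell_extension[OF insert.hyps(1), of J m b \<phi>] section_on_subset[OF insert.prems(3), of _ K] insert.prems(1,2) face_X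
    unfolding C_def by (metis Un_insert_left insert_disjoint(1) insert_subset subset_insertI Int_lower2 subset_refl)
  obtain \<phi>' where \<phi>': "section_on m b (insert k K) (T \<union> cell_bd m (insert k J) C) \<phi>'"
    "\<And>w j. w \<in> T \<union> cell_bd m J C \<Longrightarrow> j < m \<Longrightarrow> \<phi>' w j = \<phi> w j"
  proof (rule paste_face[of C m k J K T b \<phi> \<psi>])
    have "T = cell_ends m C \<inter> (\<Union>k<m. {w. cmod (w k) = 1})" by (auto simp: T_def C_def)
    then show "closed T" by (auto intro!: closed_Int closed_cell_ends closed_UN closed_cmod_eq_1)
    show "w(l := 1) \<in> T" if "w \<in> T" "l \<in> C" for w l
      using that cell_upd[of w m C l] by (auto simp: T_def C_def cell_ends_def intro!: exI[of _ l])
    show "\<psi> w j = \<phi> w j" if "w \<in> cell m (C - {k})" "w \<in> T \<union> cell_bd m J C" "j < m" for w j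
      using \<psi>(2) face_X that unfolding Fk by blast
    show "section_on m b K (cell m (C - {k})) \<psi>" unfolding Fk by (rule \<psi>(1))
  qed (use insert.prems insert.hyps k in \<open>auto simp: T_def C_def cell_ends_def\<close>)
  have "K \<inter> insert k J = {}" "K \<union> insert k J = C" using insert.prems insert.hyps by auto
  then obtain \<theta> where \<theta>: "section_on m b {} (cell_bd m C C) \<theta>" "\<And>w j. w \<in> T \<Longrightarrow> j < m \<Longrightarrow> \<theta> w j = \<phi>' w j"
    using insert.IH[of "insert k J" \<phi>'] section_on_subset[OF \<phi>'(1) order_refl subset_insertI] by blast
  then show ?case using \<phi>'(2) by (intro exI[of _ \<theta>]) auto
qed

subsection \<open>Nonexistence of equivariant maps\<close>

lemma sym_map_cong: "(\<And>k. k < m \<Longrightarrow> v k = v' k) \<Longrightarrow> (\<And>k. k < m \<Longrightarrow> w k = w' k) \<Longrightarrow> sym_map m b v w = sym_map m b v' w'"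
  by (simp add: sym_map_def fun_eq_iff)

text \<open>For |w k| = 1 the k-th linear factor loses its constant term and is w k ^ b k times the
  factor at w k = 1, so the whole product scales.\<close>

lemma sym_map_upd:
  assumes k: "k < m" and w: "cmod (w k) = 1"
  shows "sym_map m b (\<lambda>l. of_real (1 - cmod (w l))) w j =
    w k ^ b k * sym_map m b (\<lambda>l. of_real (1 - cmod ((w(k := 1)) l))) (w(k := 1)) j"
proof -
  let ?f = "\<lambda>w l. [:complex_of_real (1 - cmod (w l)), w l ^ b l:]"
  have "(\<Prod>l<m. ?f w l) = ?f w k * (\<Prod>l\<in>{..<m} - {k}. ?f w l)"
    using k by (intro prod.remove) auto
  also have "\<dots> = Polynomial.smult (w k ^ b k) (?f (w(k := 1)) k * (\<Prod>l\<in>{..<m} - {k}. ?f (w(k := 1)) l))"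
    using w by simp
  also have "?f (w(k := 1)) k * (\<Prod>l\<in>{..<m} - {k}. ?f (w(k := 1)) l) = (\<Prod>l<m. ?f (w(k := 1)) l)"
    using k by (intro prod.remove[symmetric]) auto
  finally show ?thesis
    unfolding sym_map_def by (simp only: coeff_smult) simp
qed

text \<open>\<open>G\<close> and the model map obey the same twisted periodicity, so they can be
  joined over the boundary, which \<open>no_nonvanishing_extension\<close> excludes.\<close>

theorem no_equivariant_section:
  fixes G :: "(nat \<Rightarrow> complex) \<Rightarrow> nat \<Rightarrow> complex"
  assumes m: "m > 0" and b: "\<And>k. b k > 0"
    and Gc: "\<And>j. j < m \<Longrightarrow> continuous_on (polydisc m) (\<lambda>w. G w j)"
    and Gn: "\<And>w. w \<in> polydisc m \<Longrightarrow> \<exists>j<m. G w j \<noteq> 0"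
    and Gu: "\<And>w k j. w \<in> polydisc m \<Longrightarrow> k < m \<Longrightarrow> cmod (w k) = 1 \<Longrightarrow> j < m \<Longrightarrow>
      G w j = w k ^ b k * G (w(k := 1)) j"
  shows False
proof -
  define C where "C = {..<m}"
  define T where "T = {w \<in> cell_ends m {..<m}. \<exists>k<m. cmod (w k) = 1}"
  define s where "s w = sym_map m b (\<lambda>k. of_real (1 - cmod (w k))) w" for w
  \<comment> \<open>Coordinate m is time: \<open>G\<close> is prescribed at time 0 and the model at
    time 1.\<close>
  define \<phi> where "\<phi> w = (if w m = 0 then G w else s w)" for w
  have pd: "w \<in> polydisc m" if "w \<in> cell m {..<m}" "w m = 0" for w
    unfolding polydisc_def
  proof (intro CollectI conjI allI impI)
    fix k
    have *: "w k \<in> cell_factor m {..<m} k" using that by (simp add: cell_def)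
    show "cmod (w k) \<le> 1" if "k < m" using * that by (simp add: cell_factor_def)
    show "w k = 0" if "m \<le> k" using * that \<open>w m = 0\<close> by (cases "k = m") (auto simp: cell_factor_def)
  qed
  have sc: "continuous_on X (\<lambda>w. s w j)" for X j
    unfolding s_def
    by (intro continuous_on_sym_map continuous_intros continuous_on_subset[OF continuous_on_product_coordinates]) auto
  have "section_on m b C T \<phi>"
    unfolding section_on_def
  proof (intro conjI allI ballI impI)
    fix j assume j: "j < m"
    let ?T0 = "T \<inter> {w. w m = 0}" and ?T1 = "T \<inter> {w. w m = 1}"
    have "T = cell_ends m {..<m} \<inter> (\<Union>k<m. {w. cmod (w k) = 1})"
      by (auto simp: T_def)
    then have clT: "closed T"
      by (auto intro!: closed_Int closed_cell_ends closed_UN closed_cmod_eq_1)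
    have "continuous_on ?T0 (\<lambda>w. G w j)"
      by (rule continuous_on_subset[OF Gc[OF j]]) (auto simp: T_def cell_ends_def intro: pd)
    then have "continuous_on ?T0 (\<lambda>w. \<phi> w j)"
      by (rule continuous_on_eq) (simp add: \<phi>_def)
    moreover have "continuous_on ?T1 (\<lambda>w. \<phi> w j)"
      by (rule continuous_on_eq[OF sc]) (simp add: \<phi>_def)
    ultimately have "continuous_on (?T0 \<union> ?T1) (\<lambda>w. \<phi> w j)"
      by (intro continuous_on_closed_Un closed_Int clT closed_coord_eq)
    moreover have "?T0 \<union> ?T1 = T" by (auto simp: T_def cell_ends_def)
    ultimately show "continuous_on T (\<lambda>w. \<phi> w j)" by simp
  next
    fix w assume w: "w \<in> T"
    show "\<exists>j<m. \<phi> w j \<noteq> 0"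
    proof (cases "w m = 0")
      case True
      then show ?thesis using Gn[OF pd] w by (simp add: \<phi>_def T_def cell_ends_def)
    next
      case False
      have "\<exists>j<m. s w j \<noteq> 0"
        unfolding s_def
      proof (rule sym_map_nonzero)
        show "of_real (1 - cmod (w k)) \<noteq> (0::complex) \<or> w k \<noteq> 0" for k
          by (cases "w k = 0") auto
        obtain k where "k < m" "cmod (w k) = 1" using w by (auto simp: T_def)
        then show "\<exists>k<m. w k \<noteq> 0" by (intro exI[of _ k]) auto
      qed (rule b)
      then show ?thesis using False by (simp add: \<phi>_def)
    qed
  next
    fix k w j assume k: "k \<in> C" and w: "w \<in> T" "cmod (w k) = 1" and j: "j < m"
    have km: "k < m" using k by (simp add: C_def)
    show "\<phi> w j = w k ^ b k * \<phi> (w(k := 1)) j"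
    proof (cases "w m = 0")
      case True
      then have "w \<in> polydisc m" using pd w by (simp add: T_def cell_ends_def)
      then show ?thesis using Gu[of w k j] w(2) j True km by (simp add: \<phi>_def)
    next
      case False
      then show ?thesis using sym_map_upd[of k m w b j] w(2) km by (simp add: \<phi>_def s_def)
    qed
  qed
  \<comment> \<open>No face has been filled yet: all coordinates carry the condition and
    \<open>J\<close> is empty.\<close>
  then have "\<exists>\<psi>. section_on m b {} (cell_bd m C C) \<psi> \<and> (\<forall>w\<in>T. \<forall>j<m. \<psi> w j = \<phi> w j)"
    using boundary_extension[of C "{}" m b \<phi>] by (simp add: C_def T_def cell_bd_def)
  then obtain \<psi> where \<psi>: "section_on m b {} (cell_bd m C C) \<psi>" "\<And>w j. w \<in> T \<Longrightarrow> j < m \<Longrightarrow> \<psi> w j = \<phi> w j"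
    by blast
  have cyl: "w(m := of_real t) \<in> cell_bd m C C" if "t \<in> {0..1}" "w \<in> polydisc_bd m" for w t
    using that by (auto simp: cell_bd_def cell_def cell_factor_def C_def polydisc_bd_def polydisc_def)
  have ends: "w(m := 0) \<in> T" "w(m := 1) \<in> T" if "w \<in> polydisc_bd m" for w
    using that by (auto simp: T_def cell_ends_def cell_def cell_factor_def polydisc_bd_def polydisc_def image_iff intro: bexI[of _ 0] bexI[of _ 1])
  show False
  proof (rule no_nonvanishing_extension[OF m b Gc Gn])
    show "continuous_on ({0..1} \<times> polydisc_bd m) (\<lambda>z. \<psi> ((snd z)(m := of_real (fst z))) j)" if j: "j < m" for j
    proof (rule continuous_on_compose2[OF section_on_continuous[OF \<psi>(1) j]])
      show "continuous_on ({0..1} \<times> polydisc_bd m) (\<lambda>z. (snd z)(m := complex_of_real (fst z)))"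
      proof (rule continuous_on_coordinatewise_then_product)
        fix i
        have "continuous_on ({0..1::real} \<times> polydisc_bd m) (\<lambda>z. snd z i)"
          by (rule continuous_on_product_then_coordinatewise[OF continuous_on_snd[OF continuous_on_id]])
        then show "continuous_on ({0..1} \<times> polydisc_bd m) (\<lambda>z. ((snd z)(m := complex_of_real (fst z))) i)"
          by (cases "i = m") (auto intro!: continuous_intros)
      qed
    qed (use cyl in auto)
    show "\<exists>j<m. \<psi> (w(m := of_real t)) j \<noteq> 0" if "t \<in> {0..1}" "w \<in> polydisc_bd m" for t w
      using section_on_nonzero[OF \<psi>(1) cyl[OF that]] .
    show "\<psi> (w(m := of_real 0)) j = G w j" if w: "w \<in> polydisc_bd m" "j < m" for w j
    proof -
      have "w(m := 0) = w" using w by (auto simp: polydisc_bd_def polydisc_def)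
      then show ?thesis using \<psi>(2)[OF ends(1)[OF w(1)] w(2)] fun_upd_same[of w m 0] by (simp add: \<phi>_def del: fun_upd_same)
    qed
    show "\<psi> (w(m := of_real 1)) j = sym_map m b (\<lambda>k. of_real (1 - cmod (w k))) w j" if w: "w \<in> polydisc_bd m" "j < m" for w j
    proof -
      have "\<psi> (w(m := 1)) j = s (w(m := 1)) j"
        using \<psi>(2)[OF ends(2)[OF w(1)] w(2)] by (simp add: \<phi>_def)
      also have "s (w(m := 1)) = sym_map m b (\<lambda>k. of_real (1 - cmod (w k))) w"
        unfolding s_def by (rule sym_map_cong) auto
      finally show ?thesis by (simp only: of_real_1)
    qed
  qed
qed

text \<open>\<open>\<kappa>\<close> assigns to each factor of the power of the j-th linear form the
  variable it contributes to a monomial. The fibre bound lets the product of the forms assigned to i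
  fit into complex n i-space; then component j of \<open>f\<close> gives a forbidden
  section.\<close>

theorem no_equivariant_map:
  fixes n :: "'r::finite \<Rightarrow> nat" and m :: "'s::finite \<Rightarrow> nat" and A :: "int ^ 'r ^ 's"
  assumes f: "equivariant_map torus (torus_hom A) scalar_act (sphere_prod n) scalar_act (sphere_prod m) f"
    and mj: "m j > 0" and \<kappa>: "\<And>k. k < m j \<Longrightarrow> A $ j $ \<kappa> k \<noteq> 0"
    and card: "\<And>i. card {k. k < m j \<and> \<kappa> k = i} < n i"
  shows False
proof -
  define S where "S i = {k. k < m j \<and> \<kappa> k = i}" for i
  have finS: "finite (S i)" for i by (simp add: S_def)
  \<comment> \<open>The pair (w k, 1 - |w k|) never vanishes and is (w k, 0) on the boundary circle,
    where the polynomial is therefore w k times its value at w k = 1.\<close>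
  define q where "q i w = (\<Prod>k\<in>S i. [:w k, complex_of_real (1 - cmod (w k)):])" for i and w :: "nat \<Rightarrow> complex"
  have q_nz: "q i w \<noteq> 0" for i w
    unfolding q_def using finS by auto
  have q_coeff: "poly.coeff (q i w) l = 0" if "n i \<le> l" for i w l
  proof -
    have "Polynomial.degree (q i w) \<le> (\<Sum>k\<in>S i. Polynomial.degree [:w k, complex_of_real (1 - cmod (w k)):])"
      unfolding q_def using degree_prod_sum_le[OF finS[of i], of "\<lambda>k. [:w k, complex_of_real (1 - cmod (w k)):]"] by (simp add: o_def)
    also have "\<dots> \<le> (\<Sum>k\<in>S i. 1)" by (rule sum_mono) simp
    also have "\<dots> < n i" using card[of i] by (simp add: S_def)
    finally show ?thesis using that by (simp add: coeff_eq_0)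
  qed
  define N where "N i w = (\<Sum>l<n i. (cmod (poly.coeff (q i w) l))\<^sup>2)" for i w
  have N: "N i w > 0" for i w
  proof -
    have "poly.coeff (q i w) (Polynomial.degree (q i w)) \<noteq> 0" using q_nz by simp
    moreover from this have "Polynomial.degree (q i w) < n i" using q_coeff not_less by blast
    ultimately show ?thesis unfolding N_def by (intro sum_pos2[of _ "Polynomial.degree (q i w)"]) auto
  qed
  \<comment> \<open>For a < 0 and |z| = 1, \<open>cnj z powi a\<close> equals z ^ |a|, so
    conjugation makes all exponents \<open>b k\<close> positive.\<close>
  define cj where "cj i = (if A $ j $ i < 0 then cnj else (\<lambda>z. z))" for i
  have cj: "cmod (cj i z) = cmod z" "cj i (x * y) = cj i x * cj i y" "cj i 0 = 0" for i x y z
    by (auto simp: cj_def)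
  define \<Theta> where "\<Theta> w = (\<lambda>i l. cj i (poly.coeff (q i w) l / of_real (sqrt (N i w))))" for w
  have \<Theta>: "\<Theta> w \<in> sphere_prod n" for w
  proof -
    have "(\<Sum>l<n i. (cmod (\<Theta> w i l))\<^sup>2) = 1" for i
    proof -
      have "(\<Sum>l<n i. (cmod (\<Theta> w i l))\<^sup>2) = (\<Sum>l<n i. (cmod (poly.coeff (q i w) l))\<^sup>2 / N i w)"
        using N[of i w] by (simp add: \<Theta>_def cj norm_divide power_divide)
      also have "\<dots> = N i w / N i w"
        by (simp only: N_def sum_divide_distrib)
      finally show ?thesis using N[of i w] by simp
    qed
    then show ?thesis
      by (simp add: sphere_prod_def csphere_def) (simp add: \<Theta>_def q_coeff cj)
  qed
  have qc: "continuous_on X (\<lambda>w. poly.coeff (q i w) l)" for X i l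
    unfolding q_def
    by (intro continuous_on_coeff_prod_linear finS continuous_intros continuous_on_subset[OF continuous_on_product_coordinates]) auto
  have \<Theta>c: "continuous_on X \<Theta>" for X
  proof (intro continuous_on_coordinatewise_then_product)
    fix i l
    have c: "continuous_on X (\<lambda>w. poly.coeff (q i w) l / of_real (sqrt (N i w)))"
    proof (intro continuous_intros qc)
      show "continuous_on X (N i)" unfolding N_def by (intro continuous_intros qc)
      show "\<forall>w\<in>X. complex_of_real (sqrt (N i w)) \<noteq> 0" using N by (metis less_irrefl of_real_eq_0_iff real_sqrt_eq_zero_cancel_iff)
    qed
    show "continuous_on X (\<lambda>w. \<Theta> w i l)"
      unfolding \<Theta>_def cj_def using continuous_on_cnj[OF c] c by (cases "A $ j $ i < 0") simp_all
  qed
  \<comment> \<open>Positivity is demanded at every index; beyond \<open>m j\<close> the value 1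
    supplies it.\<close>
  define b where "b k = (if k < m j then nat \<bar>A $ j $ \<kappa> k\<bar> else 1)" for k
  define G where "G w = f (\<Theta> w) j" for w
  have fS: "f x \<in> sphere_prod m" if "x \<in> sphere_prod n" for x
    using f that by (auto simp: equivariant_map_def)
  show False
  proof (rule no_equivariant_section[OF mj])
    show "b k > 0" for k using \<kappa> by (simp add: b_def)
    show "continuous_on (polydisc (m j)) (\<lambda>w. G w l)" for l
    proof -
      have "continuous_on (sphere_prod n) f" using f by (simp add: equivariant_map_def)
      then have "continuous_on (polydisc (m j)) (\<lambda>w. f (\<Theta> w))"
        by (rule continuous_on_compose2[OF _ \<Theta>c]) (use \<Theta> in auto)
      then show ?thesis
        unfolding G_def
        by (rule continuous_on_product_then_coordinatewise[OF continuous_on_product_then_coordinatewise])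
    qed
    show "\<exists>l<m j. G w l \<noteq> 0" for w
    proof -
      have "G w \<in> csphere (m j)" using fS[OF \<Theta>, of w] by (simp add: sphere_prod_def G_def)
      then show ?thesis by (rule csphere_nonzero)
    qed
    show "G w l = w k ^ b k * G (w(k := 1)) l" if k: "k < m j" and w: "cmod (w k) = 1" for w k l
    proof -
      let ?w = "w(k := 1)" and ?i = "\<kappa> k"
      \<comment> \<open>Passing from w k = 1 to w k on the circle is the action of the single circle
        factor \<open>\<kappa> k\<close> on \<open>\<Theta>\<close>.\<close>
      define z where "z i = (if i = ?i then cj i (w k) else 1)" for i
      have kS: "k \<in> S ?i" "\<And>i. i \<noteq> ?i \<Longrightarrow> k \<notin> S i" using k by (auto simp: S_def)
      have qi: "q ?i w = Polynomial.smult (w k) (q ?i ?w)"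
      proof -
        let ?f = "\<lambda>w l. [:w l, complex_of_real (1 - cmod (w l)):]"
        have "q ?i w = ?f w k * (\<Prod>l\<in>S ?i - {k}. ?f w l)"
          unfolding q_def using kS finS by (intro prod.remove) auto
        also have "\<dots> = Polynomial.smult (w k) (?f ?w k * (\<Prod>l\<in>S ?i - {k}. ?f ?w l))"
          using w by simp
        also have "?f ?w k * (\<Prod>l\<in>S ?i - {k}. ?f ?w l) = q ?i ?w"
          unfolding q_def using kS finS by (intro prod.remove[symmetric]) auto
        finally show ?thesis .
      qed
      have qo: "q i w = q i ?w" if "i \<noteq> ?i" for i
        unfolding q_def using kS(2)[OF that] by (intro prod.cong) auto
      have Ni: "N i w = N i ?w" for i
        by (cases "i = ?i") (auto simp: N_def qi qo norm_mult w)
      have "\<Theta> w = scalar_act z (\<Theta> ?w)"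
      proof (intro ext)
        show "\<Theta> w i l = scalar_act z (\<Theta> ?w) i l" for i l
          by (cases "i = ?i") (simp_all add: \<Theta>_def scalar_act_def z_def Ni qi qo flip: cj(2))
      qed
      moreover have z: "z \<in> torus"
        using w by (simp add: torus_def z_def cj)
      ultimately have "f (\<Theta> w) = scalar_act (torus_hom A z) (f (\<Theta> ?w))"
        using f \<Theta> by (simp add: equivariant_map_def)
      then have "G w l = torus_hom A z j * G ?w l"
        by (simp add: G_def scalar_act_def)
      moreover have "torus_hom A z j = w k ^ b k"
      proof -
        have "torus_hom A z j = (\<Prod>i\<in>UNIV. if i = ?i then cj ?i (w k) powi (A $ j $ ?i) else 1)"
          unfolding torus_hom_def by (rule prod.cong) (auto simp: z_def)
        also have "\<dots> = cj ?i (w k) powi (A $ j $ ?i)"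
          by simp
        also have "\<dots> = w k ^ b k"
        proof (cases "A $ j $ ?i < 0")
          case True
          have "w k * cnj (w k) = 1"
            using w by (simp add: complex_norm_square[symmetric])
          then have "inverse (cnj (w k)) = w k"
            by (metis inverse_unique mult.commute)
          then show ?thesis
            using True k by (simp add: cj_def b_def power_int_def power_inverse)
        next
          case False
          then show ?thesis using k by (simp add: cj_def b_def power_int_def)
        qed
        finally show ?thesis .
      qed
      ultimately show ?thesis by simp
    qed
  qed
qed

subsection \<open>Monomials of powers of linear forms\<close>

lemma pvar_power: "pvar i ^ k = Poly_Mapping.single (Poly_Mapping.single i k) 1"
proof (induction k)
  case (Suc k)
  have "pvar i ^ Suc k = Poly_Mapping.single (Poly_Mapping.single i 1 + Poly_Mapping.single i k) 1"
    unfolding power_Suc Suc unfolding pvar_def mult_single by simp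
  then show ?case by (simp flip: single_add)
qed simp

lemma sum_single_lookup: "p = (\<Sum>\<alpha>\<in>Poly_Mapping.keys p. Poly_Mapping.single \<alpha> (Poly_Mapping.lookup p \<alpha>))"
  by (rule poly_mapping_eqI) (simp add: lookup_sum lookup_single when_def sum.delta in_keys_iff)

text \<open>A monomial with one sufficiently large exponent is a multiple of the corresponding
  generator.\<close>

lemma in_ideal_gen_if_keys:
  fixes p :: "'r zpoly"
  assumes "\<And>\<alpha>. \<alpha> \<in> Poly_Mapping.keys p \<Longrightarrow> \<exists>i. n i \<le> Poly_Mapping.lookup \<alpha> i"
  shows "p \<in> ideal_gen (range (\<lambda>i. pvar i ^ n i))"
proof -
  interpret Modules.module "(*) :: 'r zpoly \<Rightarrow> _" by (rule module_mult)
  have "Poly_Mapping.single \<alpha> c \<in> span (range (\<lambda>i. pvar i ^ n i))" if "\<alpha> \<in> Poly_Mapping.keys p" for \<alpha> and c :: int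
  proof -
    obtain i where i: "n i \<le> Poly_Mapping.lookup \<alpha> i" using assms \<open>\<alpha> \<in> _\<close> by blast
    have "\<alpha> = (\<alpha> - Poly_Mapping.single i (n i)) + Poly_Mapping.single i (n i)"
      by (rule poly_mapping_eqI) (use i in \<open>auto simp: lookup_add lookup_minus lookup_single when_def\<close>)
    then have "Poly_Mapping.single \<alpha> c = Poly_Mapping.single (\<alpha> - Poly_Mapping.single i (n i)) c * pvar i ^ n i"
      by (simp add: pvar_power mult_single)
    then show ?thesis by (simp add: span_scale span_base)
  qed
  then have "(\<Sum>\<alpha>\<in>Poly_Mapping.keys p. Poly_Mapping.single \<alpha> (Poly_Mapping.lookup p \<alpha>)) \<in> span (range (\<lambda>i. pvar i ^ n i))"
    by (intro span_sum)
  then show ?thesis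
    unfolding ideal_gen_def by (simp flip: sum_single_lookup)
qed

lemma keys_lin_form:
  fixes A :: "int ^ 'r::finite ^ 's::finite"
  assumes "\<alpha> \<in> Poly_Mapping.keys (lin_form A j)"
  obtains i where "\<alpha> = Poly_Mapping.single i 1" "A $ j $ i \<noteq> 0"
proof -
  have "Poly_Mapping.keys (lin_form A j) \<subseteq> (\<Union>i. Poly_Mapping.keys (of_int (A $ j $ i) * pvar i))"
    unfolding lin_form_def by (rule keys_sum)
  then obtain i where i: "\<alpha> \<in> Poly_Mapping.keys (of_int (A $ j $ i) * pvar i)"
    using assms by blast
  moreover have "of_int (A $ j $ i) * pvar i = Poly_Mapping.single (Poly_Mapping.single i 1) (A $ j $ i)"
    by (simp add: pvar_def mult_single flip: single_of_int)
  ultimately show thesis using that[of i] by (auto split: if_splits)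
qed

text \<open>Expanding the power chooses one variable from each factor. Cancellation can only remove
  monomials, so each surviving one comes from some choice \<open>\<kappa>\<close>.\<close>

lemma keys_lin_form_power:
  fixes A :: "int ^ 'r::finite ^ 's::finite"
  assumes "\<alpha> \<in> Poly_Mapping.keys (lin_form A j ^ m)"
  shows "\<exists>\<kappa>. \<alpha> = (\<Sum>k<m. Poly_Mapping.single (\<kappa> k) 1) \<and> (\<forall>k<m. A $ j $ \<kappa> k \<noteq> 0)"
  using assms
proof (induction m arbitrary: \<alpha>)
  case (Suc m)
  then obtain \<beta> \<gamma> where *: "\<beta> \<in> Poly_Mapping.keys (lin_form A j)" "\<gamma> \<in> Poly_Mapping.keys (lin_form A j ^ m)" "\<alpha> = \<beta> + \<gamma>"
    using keys_mult[of "lin_form A j" "lin_form A j ^ m"] by auto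
  obtain i where i: "\<beta> = Poly_Mapping.single i 1" "A $ j $ i \<noteq> 0"
    using keys_lin_form[OF *(1)] .
  obtain \<kappa> where \<kappa>: "\<gamma> = (\<Sum>k<m. Poly_Mapping.single (\<kappa> k) 1)" "\<forall>k<m. A $ j $ \<kappa> k \<noteq> 0"
    using Suc.IH[OF *(2)] by blast
  have "(\<Sum>k<m. Poly_Mapping.single ((\<kappa>(m := i)) k) (1::nat)) = (\<Sum>k<m. Poly_Mapping.single (\<kappa> k) 1)"
    by (rule sum.cong) auto
  then have "\<alpha> = (\<Sum>k<Suc m. Poly_Mapping.single ((\<kappa>(m := i)) k) 1)"
    using * i \<kappa> by (simp add: add.commute)
  moreover have "\<forall>k<Suc m. A $ j $ (\<kappa>(m := i)) k \<noteq> 0"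
    using i \<kappa> by (auto simp: less_Suc_eq)
  ultimately show ?case by blast
qed simp

lemma lookup_sum_single:
  fixes m :: nat
  shows "Poly_Mapping.lookup (\<Sum>k<m. Poly_Mapping.single (\<kappa> k) (1::nat)) i = card {k. k < m \<and> \<kappa> k = i}"
proof -
  have "Poly_Mapping.lookup (\<Sum>k<m. Poly_Mapping.single (\<kappa> k) (1::nat)) i = (\<Sum>k<m. if \<kappa> k = i then 1 else (0::nat))"
    by (simp add: lookup_sum lookup_single when_def del: One_nat_def)
  also have "\<dots> = card ({..<m} \<inter> {k. \<kappa> k = i})"
    by (simp add: sum.If_cases)
  also have "{..<m} \<inter> {k. \<kappa> k = i} = {k. k < m \<and> \<kappa> k = i}" by auto
  finally show ?thesis .
qed

theorem proposition5p4:
  fixes n :: "'r::finite \<Rightarrow> nat" and m :: "'s::finite \<Rightarrow> nat" and A :: "int ^ 'r ^ 's"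
  assumes "\<And>i. n i > 0" and "\<And>j. m j > 0"
  shows "((\<exists>f. equivariant_map torus (torus_hom A)
                 scalar_act (sphere_prod n) scalar_act (sphere_prod m) f) \<longrightarrow>
            ideal_gen (range (\<lambda>j. lin_form A j ^ m j)) \<subseteq> ideal_gen (range (\<lambda>i. pvar i ^ n i)))
       \<and> ((\<exists>j. lin_form A j ^ m j \<notin> ideal_gen (range (\<lambda>i. pvar i ^ n i))) \<longrightarrow>
            \<not> (\<exists>f. equivariant_map torus (torus_hom A)
                     scalar_act (sphere_prod n) scalar_act (sphere_prod m) f))"
proof -
  have key: "lin_form A j ^ m j \<in> ideal_gen (range (\<lambda>i. pvar i ^ n i))"
    if f: "equivariant_map torus (torus_hom A) scalar_act (sphere_prod n) scalar_act (sphere_prod m) f" for f j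
  proof (rule in_ideal_gen_if_keys, rule ccontr)
    \<comment> \<open>The exponent of variable i in the monomial is the size of the fibre of
      \<open>\<kappa>\<close> over i, so small exponents are exactly the fibre bound of
      \<open>no_equivariant_map\<close>.\<close>
    fix \<alpha> assume "\<alpha> \<in> Poly_Mapping.keys (lin_form A j ^ m j)" and small: "\<nexists>i. n i \<le> Poly_Mapping.lookup \<alpha> i"
    then obtain \<kappa> where \<kappa>: "\<alpha> = (\<Sum>k<m j. Poly_Mapping.single (\<kappa> k) 1)" "\<And>k. k < m j \<Longrightarrow> A $ j $ \<kappa> k \<noteq> 0"
      using keys_lin_form_power by blast
    have card: "card {k. k < m j \<and> \<kappa> k = i} < n i" for i
      using small unfolding \<kappa>(1) lookup_sum_single not_ex not_le ..
    show False
      by (rule no_equivariant_map[where \<kappa> = \<kappa>, OF f assms(2) \<kappa>(2) card])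
  qed
  have "ideal_gen (range (\<lambda>j. lin_form A j ^ m j)) \<subseteq> ideal_gen (range (\<lambda>i. pvar i ^ n i))"
    if "equivariant_map torus (torus_hom A) scalar_act (sphere_prod n) scalar_act (sphere_prod m) f" for f
    using key[OF that] unfolding ideal_gen_def
    by (intro Modules.module.span_minimal[OF module_mult] Modules.module.subspace_span[OF module_mult]) blast
  then show ?thesis
    using key by blast
qed

end
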